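(* Let $0<p,q<\infty$, let $\omega$ be a radial weight, and let $AX\in\{AL^q_p(\omega),AT^q_p(\omega)\}$. For $\lambda\in\overline{\mathbb{D}}$ and $f\in\mathcal{H}(\mathbb{D})$ write $f_\lambda(z)=f(\lambda z)$, $z\in\mathbb{D}$. Then the following statements hold: (i) There exists a constant $C=C(p,q)>0$ such that $\|f_\lambda\|_{AX}\le C\|f\|_{AX}$ for all $\lambda\in\overline{\mathbb{D}}$ and $f\in\mathcal{H}(\mathbb{D})$; (ii) $\displaystyle\lim_{\lambda\to\zeta,\ \lambda\in\overline{\mathbb{D}}}\|f_\lambda-f_\zeta\|_{AX}=0$ for each $f\in AX$ and $\zeta\in\overline{\mathbb{D}}$; (iii) Polynomials are dense in $AX$.
   Context: $\mathbb{D}$ is the open unit disc, $\mathbb{T}=\partial\mathbb{D}$, $\mathcal{H}(\mathbb{D})$ is the space of analytic functions in $\mathbb{D}$, and $dA=\frac{dx\,dy}{\pi}$. A weight is a function $\omega:\mathbb{D}\to[0,\infty)$ integrable over $\mathbb{D}$; it is radial if $\omega(z)=\omega(|z|)$ for all $z\in\mathbb{D}$. Throughout, it is assumed that $\widehat{\omega}(z)=\int_{|z|}^1\omega(s)\,ds>0$ for all $z\in\mathbb{D}$. For $\xi\in\overline{\mathbb{D}}$, $\Gamma(\xi)=\{z\in\mathbb{D}:|\arg z-\arg\xi|<|\xi|-|z|\}$ (difference of arguments modulo $2\pi$). For $0<p,q<\infty$, $L^q_p(\omega)$ and $T^q_p(\omega)$ consist of the complex-valued measurable functions $f$ on $\mathbb{D}$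 such that, respectively, $$\|f\|_{L^q_p(\omega)}=\left(\frac1{2\pi}\int_0^{2\pi}\left(\int_0^1|f(re^{i\theta})|^p\omega(r)r\,dr\right)^{q/p}d\theta\right)^{1/q}<\infty,$$ $$\|f\|_{T^q_p(\omega)}=\left(\int_{\mathbb{T}}\left(\int_{\Gamma(\xi)}|f(z)|^p\omega(z)\frac{dA(z)}{1-|z|}\right)^{q/p}|d\xi|\right)^{1/q}<\infty.$$ Set $AL^q_p(\omega)=L^q_p(\omega)\cap\mathcal{H}(\mathbb{D})$ and $AT^q_p(\omega)=T^q_p(\omega)\cap\mathcal{H}(\mathbb{D})$, with the inherited quasinorms $\|\cdot\|_{AL^q_p(\omega)}=\|\cdot\|_{L^q_p(\omega)}$ and $\|\cdot\|_{AT^q_p(\omega)}=\|\cdot\|_{T^q_p(\omega)}$ (taking the value $+\infty$ on $f\in\mathcal{H}(\mathbb{D})$ outside the space). *)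

theory Defs
  imports "HOL-Analysis.Analysis" "HOL-Computational_Algebra.Polynomial"
begin

abbreviation unit_disc :: "complex set" where
  "unit_disc \<equiv> ball 0 1"

text \<open>Real powers of extended nonnegative reals, meant for a positive exponent.\<close>

definition epowr :: "ennreal \<Rightarrow> real \<Rightarrow> ennreal" where
  "epowr x a = (if x = \<infinity> then \<infinity> else ennreal (enn2real x powr a))"

definition weight :: "(complex \<Rightarrow> real) \<Rightarrow> bool" where
  "weight \<omega> \<longleftrightarrow> (\<forall>z\<in>unit_disc. 0 \<le> \<omega> z) \<and> set_integrable lebesgue unit_disc \<omega>"

text \<open>The tail integral is extended-valued: integrability over the disc controls only
  \<open>\<omega> s * s\<close> near \<open>s = 0\<close>, so the tail from \<open>z = 0\<close> may be infinite.\<close>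

definition weight_hat :: "(complex \<Rightarrow> real) \<Rightarrow> complex \<Rightarrow> ennreal" where
  "weight_hat \<omega> z = (\<integral>\<^sup>+s\<in>{cmod z..<1}. ennreal (\<omega> (of_real s)) \<partial>lebesgue)"

text \<open>The standing assumption that all tail integrals are positive is included.\<close>

definition radial_weight :: "(complex \<Rightarrow> real) \<Rightarrow> bool" where
  "radial_weight \<omega> \<longleftrightarrow>
     weight \<omega> \<and> (\<forall>z\<in>unit_disc. \<omega> z = \<omega> (of_real (cmod z))) \<and>
     (\<forall>z\<in>unit_disc. 0 < weight_hat \<omega> z)"

text \<open>The integer \<open>k\<close> expresses that arguments are compared modulo \<open>2\<pi>\<close>. The convention
  \<open>Arg 0 = 0\<close> affects only the membership of the single point \<open>z = 0\<close> when \<open>\<xi> \<noteq> 0\<close>;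
  for \<open>\<xi> = 0\<close> the region is empty.\<close>

definition tangential_region :: "complex \<Rightarrow> complex set" where
  "tangential_region \<xi> =
     {z \<in> unit_disc. \<exists>k::int. \<bar>Arg z - Arg \<xi> + 2 * pi * of_int k\<bar> < cmod \<xi> - cmod z}"

text \<open>Lower index \<open>p\<close> (inner exponent) comes first, upper index \<open>q\<close> (outer exponent) second.\<close>

definition L_norm :: "real \<Rightarrow> real \<Rightarrow> (complex \<Rightarrow> real) \<Rightarrow> (complex \<Rightarrow> complex) \<Rightarrow> ennreal" where
  "L_norm p q \<omega> f =
     epowr (ennreal (1 / (2 * pi)) *
       (\<integral>\<^sup>+\<theta>\<in>{0..2 * pi}.
          epowr (\<integral>\<^sup>+r\<in>{0..<1}.
                   ennreal (cmod (f (rcis r \<theta>)) powr p * \<omega> (of_real r) * r) \<partial>lebesgue)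
                (q / p) \<partial>lebesgue)) (1 / q)"

text \<open>The unit circle is parametrized by \<open>cis\<close>; the factor \<open>1 / pi\<close> normalizes area.\<close>

definition T_norm :: "real \<Rightarrow> real \<Rightarrow> (complex \<Rightarrow> real) \<Rightarrow> (complex \<Rightarrow> complex) \<Rightarrow> ennreal" where
  "T_norm p q \<omega> f =
     epowr (\<integral>\<^sup>+t\<in>{0..2 * pi}.
          epowr (ennreal (1 / pi) *
                 (\<integral>\<^sup>+z\<in>tangential_region (cis t).
                   ennreal (cmod (f z) powr p * \<omega> z / (1 - cmod z)) \<partial>lebesgue))
                (q / p) \<partial>lebesgue) (1 / q)"

definition L_space :: "real \<Rightarrow> real \<Rightarrow> (complex \<Rightarrow> real) \<Rightarrow> (complex \<Rightarrow> complex) set" where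
  "L_space p q \<omega> = {f \<in> borel_measurable (lebesgue_on unit_disc). L_norm p q \<omega> f < \<infinity>}"

definition T_space :: "real \<Rightarrow> real \<Rightarrow> (complex \<Rightarrow> real) \<Rightarrow> (complex \<Rightarrow> complex) set" where
  "T_space p q \<omega> = {f \<in> borel_measurable (lebesgue_on unit_disc). T_norm p q \<omega> f < \<infinity>}"

text \<open>Functions are total on \<^typ>\<open>complex\<close>; their values off the disc are irrelevant.\<close>

definition H_disc :: "(complex \<Rightarrow> complex) set" where
  "H_disc = {f. f holomorphic_on unit_disc}"

definition AL :: "real \<Rightarrow> real \<Rightarrow> (complex \<Rightarrow> real) \<Rightarrow> (complex \<Rightarrow> complex) set" where
  "AL p q \<omega> = L_space p q \<omega> \<inter> H_disc"

definition AT :: "real \<Rightarrow> real \<Rightarrow> (complex \<Rightarrow> real) \<Rightarrow> (complex \<Rightarrow> complex) set" where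
  "AT p q \<omega> = T_space p q \<omega> \<inter> H_disc"

definition dilate :: "complex \<Rightarrow> (complex \<Rightarrow> complex) \<Rightarrow> complex \<Rightarrow> complex" where
  "dilate c f = (\<lambda>z. f (c * z))"

text \<open>Density of \<open>D\<close> in \<open>X\<close> for the quasinorm \<open>N\<close>, including \<open>D \<subseteq> X\<close>.\<close>

definition quasinorm_dense ::
  "(complex \<Rightarrow> complex) set \<Rightarrow> (complex \<Rightarrow> complex) set \<Rightarrow> ((complex \<Rightarrow> complex) \<Rightarrow> ennreal) \<Rightarrow> bool" where
  "quasinorm_dense D X N \<longleftrightarrow>
     D \<subseteq> X \<and> (\<forall>f\<in>X. \<forall>\<epsilon>>0. \<exists>g\<in>D. N (\<lambda>z. f z - g z) < ennreal \<epsilon>)"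

end

theory Submission
  imports Defs "HOL-Complex_Analysis.Complex_Analysis" "HOL-Probability.Probability"
begin

text \<open>Both quasinorms are mixed norms: for a finite measure \<open>\<nu>\<close> on the disc they are, up to a constant,
  the \<open>q\<close>-norm over \<open>t\<close> of the \<open>L\<^sup>p(\<nu>)\<close>-norm of \<open>z \<mapsto> f (z * cis t)\<close>. For \<open>L\<close> the measure is
  \<open>\<omega> r dr\<close> on a radius; for \<open>T\<close> it is \<open>\<omega> dA / (1 - |z|)\<close> on the tangential region at \<open>1\<close>, by
  rotation invariance of area. With \<open>s = min p q\<close>, \<open>|f|\<^sup>s\<close> is dominated by its Poisson integral, so
  \<open>|f (c * z * cis t)|\<^sup>s\<close> is at most an average of \<open>|f (z * cis (t + \<tau>))|\<^sup>s\<close> over \<open>\<tau>\<close> with weights that do not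
  depend on \<open>z\<close>. Minkowski's and Jensen's inequalities turn this into (i) with \<open>C = 1\<close>. Applied to
  \<open>\<nu>\<close> restricted to \<open>|z| > R\<close>, (i) makes the tails of all dilations uniformly small; on \<open>|z| \<le> R\<close>
  dilations converge uniformly, which gives (ii). Density (iii) follows from (ii) at \<open>\<zeta> = 1\<close> and
  Taylor expansion.\<close>

text \<open>For exponents below 1 the quasinorms need not satisfy the triangle inequality; what
  survives is subharmonicity of |f|^s for every s > 0. The choice of s is dictated by two
  requirements: Minkowski over the measure on the disc needs p / s >= 1, Jensen over the angles
  needs q / s >= 1. The majorant consists of rotations only, and a rotation is a shift of t, which
  leaves the outer integral over a full period unchanged; hence the constant is 1 for every finite
  measure, and the bound can be reused for restrictions of it. Two points need separate work. First,
  the measure must be finite: for T this follows by averaging over t, since the angles whose region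
  contains a given z have total length at most 4 (1 - |z|), which cancels the singular factor.
  Second, a weight is only Lebesgue measurable on the disc, where a radius is a null set; radial
  symmetry is what makes its profile on the radius measurable, and a Borel version of the profile
  defines the measure.\<close>

section \<open>Subharmonicity of powers of the modulus\<close>

text \<open>On the circle a product of real parts of polynomials is again the real part of a polynomial,
  so Stone--Weierstrass applies to real parts of polynomials.\<close>

lemma Re_mult_on_circle:
  assumes "cmod z = 1" "m \<le> n"
  shows "Re (a * z ^ m) * Re (b * z ^ n) = Re ((a * b * z ^ (m + n) + cnj a * b * z ^ (n - m)) / 2)"
proof -
  have zc: "cnj z * z = 1"
    using assms(1) by (metis complex_norm_square mult.commute of_real_1 one_power2)
  \<comment> \<open>On the circle \<open>cnj z\<close> inverts z, so the conjugated factor cancels m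
    of the n factors z; m <= n keeps the result a polynomial.\<close>
  have "cnj (a * z ^ m) * (b * z ^ n) = cnj a * b * (cnj z * z) ^ m * z ^ (n - m)"
    using assms(2) by (simp add: power_mult_distrib flip: power_add) 
  then have *: "cnj (a * z ^ m) * (b * z ^ n) = cnj a * b * z ^ (n - m)"
    by (simp add: zc)
  have "Re x * Re y = Re ((x * y + cnj x * y) / 2)" for x y
    by (simp add: algebra_simps)
  from this[of "a * z ^ m" "b * z ^ n"] show ?thesis
    unfolding * by (simp add: power_add mult_ac)
qed

text \<open>Real trigonometric polynomials, encoded through algebraic ones. Values off the circle
  are left free, so closure properties are checked on the circle alone.\<close>

definition trig_poly :: "(complex \<Rightarrow> real) set" where
  "trig_poly = {u. \<exists>P. \<forall>z\<in>sphere 0 1. u z = Re (poly P z)}"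

lemma trig_poly_sum:
  assumes "\<And>i. i \<in> A \<Longrightarrow> u i \<in> trig_poly"
  shows "(\<lambda>z. \<Sum>i\<in>A. u i z) \<in> trig_poly"
proof -
  have "\<forall>i\<in>A. \<exists>P. \<forall>z\<in>sphere 0 1. u i z = Re (poly P z)"
    using assms unfolding trig_poly_def by blast
  then obtain P where P: "\<And>i z. i \<in> A \<Longrightarrow> z \<in> sphere 0 1 \<Longrightarrow> u i z = Re (poly (P i) z)"
    unfolding bchoice_iff by blast
  show ?thesis
    unfolding trig_poly_def by (auto simp: P poly_sum intro!: exI[of _ "\<Sum>i\<in>A. P i"])
qed

lemma trig_poly_monom_mult:
  "(\<lambda>z. Re (a * z ^ m) * Re (b * z ^ n)) \<in> trig_poly"
proof -
  have *: "(\<lambda>z. Re (a * z ^ m) * Re (b * z ^ n)) \<in> trig_poly" if "m \<le> n" for m n a b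
    unfolding trig_poly_def mem_Collect_eq
  proof (intro exI ballI)
    fix z :: complex assume "z \<in> sphere 0 1"
    then have z: "cmod z = 1" by simp
    show "Re (a * z ^ m) * Re (b * z ^ n) =
        Re (poly (monom (a * b / 2) (m + n) + monom (cnj a * b / 2) (n - m)) z)"
      unfolding Re_mult_on_circle[OF z that] by (simp only: poly_add poly_monom add_divide_distrib times_divide_eq_left)
  qed
  show ?thesis
    using *[of m n a b] *[of n m b a] by (cases m n rule: le_cases) (auto simp: mult.commute)
qed

lemma trig_poly_mult:
  assumes "u \<in> trig_poly" "v \<in> trig_poly"
  shows "(\<lambda>z. u z * v z) \<in> trig_poly"
proof -
  obtain P Q where P: "\<And>z. z \<in> sphere 0 1 \<Longrightarrow> u z = Re (poly P z)"
    and Q: "\<And>z. z \<in> sphere 0 1 \<Longrightarrow> v z = Re (poly Q z)"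
    using assms unfolding trig_poly_def by blast
  have "(\<lambda>z. \<Sum>i\<le>degree P. \<Sum>j\<le>degree Q. Re (coeff P i * z ^ i) * Re (coeff Q j * z ^ j)) \<in> trig_poly"
    by (intro trig_poly_sum trig_poly_monom_mult)
  moreover have "u z * v z = (\<Sum>i\<le>degree P. \<Sum>j\<le>degree Q. Re (coeff P i * z ^ i) * Re (coeff Q j * z ^ j))"
    if "z \<in> sphere 0 1" for z
    by (simp only: P[OF that] Q[OF that] poly_altdef Re_sum sum_product)
  ultimately show ?thesis
    unfolding trig_poly_def by auto
qed

lemma continuous_on_circle_approx_Re_poly:
  fixes u :: "complex \<Rightarrow> real"
  assumes "continuous_on (sphere 0 1) u" "e > 0"
  obtains P where "\<And>z. z \<in> sphere 0 1 \<Longrightarrow> \<bar>u z - Re (poly P z)\<bar> < e"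
proof -
  interpret function_ring_on trig_poly "sphere (0::complex) 1"
  proof
    fix f assume "f \<in> trig_poly"
    then obtain P where "\<And>z. z \<in> sphere 0 1 \<Longrightarrow> f z = Re (poly P z)"
      unfolding trig_poly_def by blast
    then show "continuous_on (sphere 0 1) f"
      by (subst continuous_on_cong[OF refl, of _ _ "\<lambda>z. Re (poly P z)"]) (auto intro!: continuous_intros)
  next
    fix f g :: "complex \<Rightarrow> real" assume *: "f \<in> trig_poly" "g \<in> trig_poly"
    show "(\<lambda>x. f x + g x) \<in> trig_poly"
      using trig_poly_sum[of "UNIV :: bool set" "\<lambda>b. if b then f else g"] * by (simp add: UNIV_bool add.commute)
    show "(\<lambda>x. f x * g x) \<in> trig_poly" using * by (rule trig_poly_mult)
  next
    fix c :: real show "(\<lambda>_. c) \<in> trig_poly"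
      unfolding trig_poly_def by (auto intro!: exI[of _ "[:of_real c:]"])
  next
    fix x y :: complex assume "x \<noteq> y"
    have "Re \<in> trig_poly" "Im \<in> trig_poly"
      \<comment> \<open>\<open>[:0, -\<i>:]\<close> is the polynomial -\<i> z, whose real part is Im
        z.\<close>
      unfolding trig_poly_def by (auto intro: exI[of _ "[:0, 1:]"] exI[of _ "[:0, -\<i>:]"])
    with \<open>x \<noteq> y\<close> show "\<exists>f\<in>trig_poly. f x \<noteq> f y" by (metis complex_eqI)
  qed simp
  obtain g where "g \<in> trig_poly" "\<forall>x\<in>sphere 0 1. \<bar>u x - g x\<bar> < e"
    using Stone_Weierstrass_basic[OF assms] by blast
  then show ?thesis using that unfolding trig_poly_def by force
qed

section \<open>The Poisson integral and the majorant for powers of the modulus\<close>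

definition poisson_kernel :: "real \<Rightarrow> real \<Rightarrow> real" where
  "poisson_kernel \<rho> t = (1 - \<rho>\<^sup>2) / (2 * pi * (cmod (1 - of_real \<rho> * cis t))\<^sup>2)"

lemma poisson_denominator_nz:
  assumes "0 \<le> \<rho>" "\<rho> < 1" shows "1 - of_real \<rho> * cis t \<noteq> 0"
  using assms by (metis abs_of_nonneg eq_iff_diff_eq_0 less_irrefl mult_cancel_right1 norm_cis norm_mult norm_of_real norm_one mult.right_neutral)

lemma poisson_kernel_nonneg:
  assumes "0 \<le> \<rho>" "\<rho> < 1" shows "0 \<le> poisson_kernel \<rho> t"
  using assms by (auto simp: poisson_kernel_def power_le_one)

lemma continuous_poisson_kernel:
  assumes "0 \<le> \<rho>" "\<rho> < 1" shows "continuous_on A (poisson_kernel \<rho>)"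
  unfolding poisson_kernel_def using poisson_denominator_nz[OF assms]
  by (intro continuous_intros) auto

text \<open>Cauchy's formula at \<rho> is applied to G z / (1 - \<rho> z) instead of G; on the
  circle the extra factor turns the Cauchy kernel into the real, positive Poisson kernel.\<close>

lemma poisson_formula:
  assumes G: "G holomorphic_on UNIV" and \<rho>: "0 \<le> \<rho>" "\<rho> < 1"
  shows "((\<lambda>t. of_real (poisson_kernel \<rho> t) * G (cis t)) has_integral G (of_real \<rho>)) {0..2*pi}"
proof -
  let ?f = "\<lambda>z. G z / (1 - of_real \<rho> * z)"
  have nz: "1 - of_real \<rho> * z \<noteq> 0" if "cmod z \<le> 1" for z
  proof
    assume "1 - of_real \<rho> * z = 0"
    then have "\<rho> * cmod z = 1" using \<rho> by (metis abs_of_nonneg eq_iff_diff_eq_0 norm_mult norm_of_real norm_one)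
    moreover have "\<rho> * cmod z \<le> \<rho> * 1" using \<rho> that by (intro mult_left_mono) auto
    ultimately show False using \<rho> by simp
  qed
  have hol: "?f holomorphic_on cball 0 1"
    using nz by (intro holomorphic_intros holomorphic_on_subset[OF G]) auto
  have "((\<lambda>u. ?f u / (u - of_real \<rho>)) has_contour_integral (2 * of_real pi * \<i> * ?f (of_real \<rho>))) (circlepath 0 1)"
    using hol \<rho> by (intro Cauchy_integral_circlepath holomorphic_on_imp_continuous_on)
      (auto intro: holomorphic_on_subset)
  then have "((\<lambda>t. ?f (cis t) / (cis t - of_real \<rho>) * \<i> * cis t) has_integral
      (2 * of_real pi * \<i> * ?f (of_real \<rho>))) {0..2*pi}"
    unfolding circlepath_def by (subst (asm) has_contour_integral_part_circlepath_iff) auto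
  \<comment> \<open>The factor cancels 2 pi \<i> and the value 1 / (1 - \<rho>^2) that the auxiliary
    denominator takes at \<rho>.\<close>
  then have "((\<lambda>t. (1 - of_real \<rho>^2) / (2 * of_real pi * \<i>) * (?f (cis t) / (cis t - of_real \<rho>) * \<i> * cis t)) has_integral
      (1 - of_real \<rho>^2) / (2 * of_real pi * \<i>) * (2 * of_real pi * \<i> * ?f (of_real \<rho>))) {0..2*pi}"
    by (rule has_integral_mult_right)
  moreover have "(1 - of_real \<rho>^2) / (2 * of_real pi * \<i>) * (2 * of_real pi * \<i> * ?f (of_real \<rho>)) = G (of_real \<rho>)"
    using nz[of "of_real \<rho>"] \<rho> by (simp add: power2_eq_square)
  moreover have "(1 - of_real \<rho>^2) / (2 * of_real pi * \<i>) * (?f (cis t) / (cis t - of_real \<rho>) * \<i> * cis t)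
      = of_real (poisson_kernel \<rho> t) * G (cis t)" for t
  proof -
    \<comment> \<open>The Cauchy denominator is the conjugate of the auxiliary one up to
      \<open>cis t\<close>, so their product is a squared modulus.\<close>
    have "cis t - of_real \<rho> = cis t * cnj (1 - of_real \<rho> * cis t)"
      by (simp add: algebra_simps cis_cnj cis_mult)
    moreover have "complex_of_real ((cmod (1 - of_real \<rho> * cis t))\<^sup>2) = (1 - of_real \<rho> * cis t) * cnj (1 - of_real \<rho> * cis t)"
      by (simp only: complex_norm_square)
    ultimately show ?thesis
      unfolding poisson_kernel_def using poisson_denominator_nz[OF \<rho>, of t]
      by (simp del: complex_cnj_diff complex_cnj_mult)
  qed
  ultimately show ?thesis by simp
qed

lemma has_integral_poisson_kernel:
  assumes \<rho>: "0 \<le> \<rho>" "\<rho> < 1"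
  shows "(poisson_kernel \<rho> has_integral 1) {0..2*pi}"
  using has_integral_Re[OF poisson_formula[of "\<lambda>_. 1", OF _ \<rho>]] by simp

text \<open>Instead of dividing out the zeros of \<open>g\<close>, approximate \<open>ln (|g|\<^sup>s + d)\<close> on the circle by \<open>Re P\<close>:
  the maximum principle bounds \<open>|g|\<^sup>s\<close> by the modulus of the entire function \<open>G = exp (P + d)\<close>, which
  satisfies the Poisson formula.\<close>

lemma norm_powr_le_poisson_integral:
  fixes g :: "complex \<Rightarrow> complex"
  assumes cont: "continuous_on (cball 0 1) g" and hol: "g holomorphic_on ball 0 1"
    and s: "0 < s" and \<rho>: "0 \<le> \<rho>" "\<rho> < 1"
  shows "cmod (g (of_real \<rho>)) powr s \<le> integral {0..2*pi} (\<lambda>t. poisson_kernel \<rho> t * cmod (g (cis t)) powr s)"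
    (is "_ \<le> ?I")
proof -
  have cg: "continuous_on {0..2*pi} (\<lambda>t. cmod (g (cis t)) powr s)"
    using s by (intro continuous_on_powr' continuous_intros continuous_on_compose2[OF cont]) auto
  have int: "(\<lambda>t. poisson_kernel \<rho> t * cmod (g (cis t)) powr s) integrable_on {0..2*pi}"
    by (intro integrable_continuous_interval continuous_on_mult cg continuous_poisson_kernel \<rho>)
  have bound: "cmod (g (of_real \<rho>)) powr s \<le> exp (2 * d) * (?I + d)" if d: "d > 0" for d
  proof -
    let ?w = "\<lambda>z. cmod (g z) powr s + d"
    have wpos: "?w z > 0" for z using d by (simp add: add_nonneg_pos)
    have "continuous_on (sphere 0 1) (\<lambda>z. ln (?w z))"
      using s wpos by (intro continuous_intros continuous_on_powr' continuous_on_subset[OF cont])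
        (auto simp: less_imp_neq[THEN not_sym] )
    then obtain P where P: "\<And>z. z \<in> sphere 0 1 \<Longrightarrow> \<bar>ln (?w z) - Re (poly P z)\<bar> < d"
      using continuous_on_circle_approx_Re_poly d by blast
    \<comment> \<open>The shift by d absorbs the approximation error: on the circle \<open>G\<close>
      dominates |g|^s + d in modulus, and exceeds it at most by the factor exp (2 d).\<close>
    define G where "G = (\<lambda>z. exp (poly P z + of_real d))"
    \<comment> \<open>\<open>h\<close> is g divided by the zero-free branch exp ((P + d) / s) of the
      power G^(1/s); it is analytic, and the maximum principle compares |g|^s with |G| inside the
      disc.\<close>
    define h where "h = (\<lambda>z. g z * exp (- ((poly P z + of_real d) / of_real s)))"
    have nG: "cmod (G z) = exp (Re (poly P z) + d)" for z by (simp add: G_def)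
    have lower: "?w z \<le> cmod (G z)" and upper: "cmod (G z) \<le> exp (2 * d) * ?w z" if "z \<in> sphere 0 1" for z
    proof -
      have "exp (ln (?w z)) \<le> exp (Re (poly P z) + d)" using P[OF that] by simp
      then show "?w z \<le> cmod (G z)" using wpos[of z] by (simp add: nG)
      have "exp (Re (poly P z) + d) \<le> exp (2 * d + ln (?w z))" using P[OF that] by simp
      then show "cmod (G z) \<le> exp (2 * d) * ?w z" using wpos[of z] by (simp add: nG exp_add)
    qed
    have nh: "cmod (h z) = cmod (g z) / cmod (G z) powr (1/s)" for z
      using s by (simp add: h_def nG norm_mult powr_def exp_minus norm_inverse norm_divide field_simps)
    have "cmod (h (of_real \<rho>)) \<le> 1"
    proof (rule maximum_modulus_frontier[of h "cball 0 1"])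
      show "h holomorphic_on interior (cball 0 1)"
        unfolding h_def using hol s by (intro holomorphic_intros) auto
      show "continuous_on (closure (cball 0 1)) h"
        unfolding h_def using cont s by (intro continuous_intros) auto
      fix z assume "z \<in> frontier (cball (0::complex) 1)"
      then have z: "z \<in> sphere 0 1" by simp
      have "cmod (g z) powr s \<le> cmod (G z)" using lower[OF z] d by simp
      then have "(cmod (g z) powr s) powr (1/s) \<le> cmod (G z) powr (1/s)"
        using s by (intro powr_mono2) auto
      then show "cmod (h z) \<le> 1" using s by (simp add: nh powr_powr divide_le_eq_1 nG)
    qed (use \<rho> in auto)
    then have "cmod (g (of_real \<rho>)) \<le> cmod (G (of_real \<rho>)) powr (1/s)"
      by (simp add: nh nG divide_le_eq_1)
    then have "cmod (g (of_real \<rho>)) powr s \<le> (cmod (G (of_real \<rho>)) powr (1/s)) powr s"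
      using s by (intro powr_mono2) auto
    also have "\<dots> = cmod (G (of_real \<rho>))" using s by (simp add: powr_powr)
    finally have 1: "cmod (g (of_real \<rho>)) powr s \<le> cmod (G (of_real \<rho>))" .
    have holG: "G holomorphic_on UNIV" unfolding G_def by (intro holomorphic_intros)
    have hi: "((\<lambda>t. exp (2*d) * (poisson_kernel \<rho> t * cmod (g (cis t)) powr s + poisson_kernel \<rho> t * d)) has_integral
        exp (2*d) * (?I + 1 * d)) {0..2*pi}"
      by (intro has_integral_mult_right has_integral_mult_left has_integral_add has_integral_poisson_kernel \<rho>
          integrable_integral int)
    have "cmod (integral {0..2*pi} (\<lambda>t. of_real (poisson_kernel \<rho> t) * G (cis t)))
       \<le> integral {0..2*pi} (\<lambda>t. exp (2*d) * (poisson_kernel \<rho> t * cmod (g (cis t)) powr s + poisson_kernel \<rho> t * d))"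
    proof (rule integral_norm_bound_integral)
      show "(\<lambda>t. of_real (poisson_kernel \<rho> t) * G (cis t)) integrable_on {0..2*pi}"
        using poisson_formula[OF holG \<rho>] by blast
      show "(\<lambda>t. exp (2*d) * (poisson_kernel \<rho> t * cmod (g (cis t)) powr s + poisson_kernel \<rho> t * d)) integrable_on {0..2*pi}"
        using hi by blast
      fix t
      have "poisson_kernel \<rho> t * cmod (G (cis t)) \<le> poisson_kernel \<rho> t * (exp (2 * d) * ?w (cis t))"
        by (intro mult_left_mono upper poisson_kernel_nonneg \<rho>) auto
      then show "cmod (of_real (poisson_kernel \<rho> t) * G (cis t)) \<le>
          exp (2*d) * (poisson_kernel \<rho> t * cmod (g (cis t)) powr s + poisson_kernel \<rho> t * d)"
        using poisson_kernel_nonneg[OF \<rho>, of t] by (simp add: norm_mult algebra_simps)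
    qed
    then have "cmod (G (of_real \<rho>)) \<le> exp (2*d) * (?I + d)"
      using integral_unique[OF poisson_formula[OF holG \<rho>]] integral_unique[OF hi] by simp
    with 1 show ?thesis by simp
  qed
  \<comment> \<open>\<open>bound\<close> holds for every positive d and \<open>?I\<close> does not
    depend on d, so d may tend to 0.\<close>
  have "((\<lambda>d. exp (2 * d) * (?I + d)) \<longlongrightarrow> exp (2 * 0) * (?I + 0)) (at_right 0)"
    by (intro tendsto_intros)
  then have "cmod (g (of_real \<rho>)) powr s \<le> exp (2 * 0) * (?I + 0)"
    by (rule tendsto_lowerbound) (auto simp: eventually_at_right_less intro!: eventually_mono[OF eventually_at_right_less[of 0]] bound)
  then show ?thesis by simp
qed

definition poisson_measure :: "real \<Rightarrow> real measure" where
  "poisson_measure \<rho> = density lborel (\<lambda>t. ennreal (indicator {0..2*pi} t * poisson_kernel \<rho> t))"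

lemma nn_integral_poisson_measure:
  assumes \<rho>: "0 \<le> \<rho>" "\<rho> < 1" and u: "continuous_on {0..2*pi} u" "\<And>t. 0 \<le> u t"
    and [measurable]: "u \<in> borel_measurable borel"
  shows "(\<integral>\<^sup>+t. ennreal (u t) \<partial>poisson_measure \<rho>) = ennreal (integral {0..2*pi} (\<lambda>t. poisson_kernel \<rho> t * u t))"
proof -
  have m: "poisson_kernel \<rho> \<in> borel_measurable borel"
    by (intro borel_measurable_continuous_onI continuous_poisson_kernel \<rho>)
  have "(\<integral>\<^sup>+t. ennreal (u t) \<partial>poisson_measure \<rho>) =
     (\<integral>\<^sup>+t. ennreal (indicator {0..2*pi} t * poisson_kernel \<rho> t) * ennreal (u t) \<partial>lborel)"
    unfolding poisson_measure_def using m by (subst nn_integral_density) auto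
  also have "\<dots> = (\<integral>\<^sup>+t. ennreal (indicator {0..2*pi} t * (poisson_kernel \<rho> t * u t)) \<partial>lborel)"
    using u(2) poisson_kernel_nonneg[OF \<rho>]
    by (intro nn_integral_cong) (auto simp: ennreal_mult' mult_ac split: split_indicator)
  also have "\<dots> = ennreal (integral {0..2*pi} (\<lambda>t. poisson_kernel \<rho> t * u t))"
  proof (rule nn_integral_has_integral_lebesgue)
    show "((\<lambda>t. poisson_kernel \<rho> t * u t) has_integral integral {0..2*pi} (\<lambda>t. poisson_kernel \<rho> t * u t)) {0..2*pi}"
      by (intro integrable_integral integrable_continuous_interval continuous_on_mult u continuous_poisson_kernel \<rho>)
  qed (use u poisson_kernel_nonneg[OF \<rho>] in auto)
  finally show ?thesis .
qed

lemma prob_space_poisson_measure: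
  assumes \<rho>: "0 \<le> \<rho>" "\<rho> < 1"
  shows "prob_space (poisson_measure \<rho>)"
proof
  have "(\<integral>\<^sup>+t. ennreal 1 \<partial>poisson_measure \<rho>) = ennreal (integral {0..2*pi} (poisson_kernel \<rho>))"
    by (subst nn_integral_poisson_measure[OF \<rho>]) auto
  then show "emeasure (poisson_measure \<rho>) (space (poisson_measure \<rho>)) = 1"
    using integral_unique[OF has_integral_poisson_kernel[OF \<rho>]] by simp
qed

lemma sets_poisson_measure [simp, measurable_cong]: "sets (poisson_measure \<rho>) = sets borel"
  by (simp add: poisson_measure_def)

text \<open>The measure does not depend on \<open>f\<close> or \<open>w\<close>, which is what allows integration over \<open>w\<close>. For
  \<open>|c| = 1\<close> it is a point mass.\<close>

lemma dilate_dominated_by_rotations: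
  assumes c: "cmod c \<le> 1" and s: "0 < s"
  obtains \<mu> :: "real measure" where "prob_space \<mu>" "sets \<mu> = sets borel"
    "\<And>f w. f holomorphic_on ball 0 1 \<Longrightarrow> w \<in> ball 0 1 \<Longrightarrow>
       ennreal (cmod (f (c * w)) powr s) \<le> (\<integral>\<^sup>+\<tau>. ennreal (cmod (f (w * cis \<tau>)) powr s) \<partial>\<mu>)"
proof (cases "cmod c = 1")
  case True
  have c: "cis (Arg c) = c" using rcis_cmod_Arg[of c] True by (simp add: rcis_def)
  show ?thesis
  proof (rule that[of "return borel (Arg c)"])
    fix f w assume f: "f holomorphic_on ball 0 1" and w: "w \<in> ball (0::complex) 1"
    have "(\<lambda>\<tau>. cmod (f (w * cis \<tau>)) powr s) \<in> borel_measurable borel"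
    proof (intro borel_measurable_continuous_onI continuous_on_powr' continuous_intros
       continuous_on_compose2[OF holomorphic_on_imp_continuous_on[OF f]])
    qed (use w s in \<open>auto simp: norm_mult\<close>)
    then show "ennreal (cmod (f (c * w)) powr s) \<le> (\<integral>\<^sup>+\<tau>. ennreal (cmod (f (w * cis \<tau>)) powr s) \<partial>return borel (Arg c))"
      by (subst nn_integral_return) (auto simp: c mult.commute)
  qed (auto intro: prob_space_return)
next
  case False
  define \<rho> where "\<rho> = cmod c"
  have \<rho>: "0 \<le> \<rho>" "\<rho> < 1" using c False by (auto simp: \<rho>_def)
  \<comment> \<open>The modulus of c determines the Poisson average, its argument only shifts the
    angles.\<close>
  define \<mu> where "\<mu> = distr (poisson_measure \<rho>) borel (\<lambda>\<tau>. \<tau> + Arg c)"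
  interpret P: prob_space "poisson_measure \<rho>" by (rule prob_space_poisson_measure[OF \<rho>])
  show ?thesis
  proof (rule that[of \<mu>])
    show "prob_space \<mu>" unfolding \<mu>_def by (rule P.prob_space_distr) simp
    show "sets \<mu> = sets borel" by (simp add: \<mu>_def)
    fix f w assume f: "f holomorphic_on ball 0 1" and w: "w \<in> ball (0::complex) 1"
    have m: "(\<lambda>\<tau>. cmod (f (w * cis (\<tau> + b))) powr s) \<in> borel_measurable borel"
        "continuous_on A (\<lambda>\<tau>. cmod (f (w * cis (\<tau> + b))) powr s)" for b A
    proof -
      show *: "continuous_on A (\<lambda>\<tau>. cmod (f (w * cis (\<tau> + b))) powr s)" for A
        by (intro continuous_on_powr' continuous_intros
         continuous_on_compose2[OF holomorphic_on_imp_continuous_on[OF f]]) (use w s in \<open>auto simp: norm_mult\<close>)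
      show "(\<lambda>\<tau>. cmod (f (w * cis (\<tau> + b))) powr s) \<in> borel_measurable borel"
        by (intro borel_measurable_continuous_onI *)
    qed
    \<comment> \<open>Since |w| < 1, \<open>g\<close> is continuous up to the circle. Its value at
      \<rho> is f (c w), and its boundary values are those of f at rotations of w.\<close>
    define g where "g = (\<lambda>u. f (w * cis (Arg c) * u))"
    have lt: "cmod w * cmod u < 1" if "cmod u \<le> 1" for u
      using w that mult_left_mono[OF that, of "cmod w"] by simp
    have "continuous_on (cball 0 1) g" unfolding g_def using lt
      by (intro continuous_intros continuous_on_compose2[OF holomorphic_on_imp_continuous_on[OF f]]) (auto simp: norm_mult)
    moreover have "g holomorphic_on ball 0 1" unfolding g_def using lt
      by (intro holomorphic_on_compose_gen[OF _ f, unfolded o_def] holomorphic_intros) (auto simp: norm_mult)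
    ultimately have le: "cmod (g (of_real \<rho>)) powr s \<le> integral {0..2*pi} (\<lambda>t. poisson_kernel \<rho> t * cmod (g (cis t)) powr s)"
      by (rule norm_powr_le_poisson_integral[OF _ _ s \<rho>])
    have ge: "g (cis \<tau>) = f (w * cis (\<tau> + Arg c))" for \<tau>
      by (simp add: g_def cis_mult[symmetric] mult_ac)
    have "c = of_real \<rho> * cis (Arg c)" unfolding \<rho>_def by (metis rcis_cmod_Arg rcis_def)
    then have "g (of_real \<rho>) = f (c * w)" by (simp add: g_def mult_ac)
    then have "ennreal (cmod (f (c * w)) powr s) \<le> ennreal (integral {0..2*pi} (\<lambda>t. poisson_kernel \<rho> t * cmod (f (w * cis (t + Arg c))) powr s))"
      using le unfolding ge by (simp add: ennreal_leI)
    also have "\<dots> = (\<integral>\<^sup>+\<tau>. ennreal (cmod (f (w * cis (\<tau> + Arg c))) powr s) \<partial>poisson_measure \<rho>)"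
      by (rule nn_integral_poisson_measure[OF \<rho>, symmetric]) (auto intro: m)
    also have "\<dots> = (\<integral>\<^sup>+\<tau>. ennreal (cmod (f (w * cis \<tau>)) powr s) \<partial>\<mu>)"
      unfolding \<mu>_def using m(1)[of 0] by (subst nn_integral_distr) auto
    finally show "ennreal (cmod (f (c * w)) powr s) \<le> (\<integral>\<^sup>+\<tau>. ennreal (cmod (f (w * cis \<tau>)) powr s) \<partial>\<mu>)" .
  qed
qed

section \<open>Jensen's and Minkowski's inequalities for extended nonnegative integrals\<close>

lemma epowr_top [simp]: "epowr top a = top"
  by (simp add: epowr_def infinity_ennreal_def)

lemma epowr_zero [simp]: "epowr 0 a = 0"
  by (simp add: epowr_def infinity_ennreal_def)

lemma epowr_ennreal [simp]: "0 \<le> r \<Longrightarrow> epowr (ennreal r) a = ennreal (r powr a)"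
  by (simp add: epowr_def infinity_ennreal_def)

lemma epowr_one [simp]: "epowr x 1 = x"
  by (cases x) auto

lemma epowr_epowr: "epowr (epowr x a) b = epowr x (a * b)"
  by (cases x) (auto simp: powr_powr)

lemma epowr_mono: "x \<le> y \<Longrightarrow> 0 \<le> a \<Longrightarrow> epowr x a \<le> epowr y a"
  by (cases x; cases y) (auto simp: powr_mono2 top_unique)

lemma epowr_mult: "epowr (x * y) a = epowr x a * epowr y a"
proof (cases x; cases y)
  fix r s assume "x = ennreal r" "y = ennreal s" "0 \<le> r" "0 \<le> s"
  then show ?thesis by (simp add: powr_mult flip: ennreal_mult)
qed (auto simp: ennreal_mult_top ennreal_top_mult)

lemma epowr_less_top [simp]: "epowr x a < top \<longleftrightarrow> x < top"
  by (cases x) auto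

lemma measurable_epowr [measurable]: "(\<lambda>x. epowr x a) \<in> borel_measurable borel"
  unfolding epowr_def by measurable

text \<open>From x + y <= 2 max x y; the crude constant has the advantage of covering convex and
  concave powers alike.\<close>

lemma epowr_add_le:
  assumes "0 \<le> a"
  shows "epowr (x + y) a \<le> ennreal (2 powr a) * (epowr x a + epowr y a)"
proof (cases x; cases y)
  fix r s assume *: "x = ennreal r" "y = ennreal s" "0 \<le> r" "0 \<le> s"
  have "(r + s) powr a \<le> (2 * max r s) powr a" using * assms by (intro powr_mono2) auto
  also have "\<dots> = 2 powr a * max r s powr a" using * by (simp add: powr_mult)
  also have "\<dots> \<le> 2 powr a * (r powr a + s powr a)"
    by (intro mult_left_mono) (auto simp: max_def)
  finally show ?thesis using * by (simp add: ennreal_leI flip: ennreal_plus ennreal_mult)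
qed (auto simp: ennreal_mult_top ennreal_top_mult)

lemma tendsto_epowr_zero:
  assumes "(f \<longlongrightarrow> 0) F" "0 < a"
  shows "((\<lambda>x. epowr (f x) a) \<longlongrightarrow> 0) F"
proof (rule order_tendstoI)
  fix e :: ennreal assume "0 < e"
  then obtain d' where d': "0 < d'" "d' < e" using dense by blast
  then obtain d where "d' = ennreal d" "0 \<le> d"
    by (metis ennreal_cases infinity_ennreal_def not_less top_greatest)
  with d' have d: "0 < d" "ennreal d < e" by auto
  have "eventually (\<lambda>x. f x < ennreal (d powr (1/a))) F"
    using d by (intro order_tendstoD(2)[OF assms(1)]) auto
  then show "eventually (\<lambda>x. epowr (f x) a < e) F"
  proof eventually_elim
    case (elim x)
    then have "epowr (f x) a \<le> epowr (ennreal (d powr (1/a))) a" using assms by (intro epowr_mono) auto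
    also have "\<dots> = ennreal d" using d assms by (simp add: powr_powr)
    finally show ?case using d by simp
  qed
qed auto

text \<open>The convex function x^a lies above its tangent at m; the inequality is rearranged so
  that no subtraction of extended values occurs. It is Young's inequality for r^a and m^a with
  weights 1/a and 1 - 1/a.\<close>

lemma epowr_tangent:
  assumes "1 \<le> a" "0 < m"
  shows "ennreal (a * m powr (a - 1)) * x \<le> epowr x a + ennreal ((a - 1) * m powr a)"
proof (cases x)
  case (real r)
  show ?thesis
  proof (cases "r = 0")
  case False
  have "(r powr a) powr (1/a) * (m powr a) powr (1 - 1/a) \<le> (1/a) * r powr a + (1 - 1/a) * m powr a"
    using assms False real by (intro Youngs_inequality_0) auto
  also have "(r powr a) powr (1/a) * (m powr a) powr (1 - 1/a) = r * m powr (a - 1)"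
    using assms real by (simp add: powr_powr right_diff_distrib)
  finally have "a * (r * m powr (a - 1)) \<le> a * ((1/a) * r powr a + (1 - 1/a) * m powr a)"
    using assms by (intro mult_left_mono) auto
  also have "a * ((1/a) * r powr a + (1 - 1/a) * m powr a) = r powr a + (a - 1) * m powr a"
    using assms by (simp add: algebra_simps)
  finally have "a * m powr (a - 1) * r \<le> r powr a + (a - 1) * m powr a"
    by (simp add: mult_ac)
  then show ?thesis using assms real by (simp add: ennreal_leI flip: ennreal_plus ennreal_mult)
  qed (use real in simp)
qed auto

text \<open>Integrate the tangent inequality at m equal to the mean of g. If the mean is infinite,
  the tangent at 1 already forces the right-hand side to be infinite.\<close>

lemma (in prob_space) jensen_epowr:
  assumes [measurable]: "g \<in> borel_measurable M" and a: "1 \<le> a"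
  shows "epowr (\<integral>\<^sup>+x. g x \<partial>M) a \<le> (\<integral>\<^sup>+x. epowr (g x) a \<partial>M)"
proof -
  let ?R = "\<integral>\<^sup>+x. epowr (g x) a \<partial>M"
  have tangent: "ennreal (a * m powr (a - 1)) * (\<integral>\<^sup>+x. g x \<partial>M) \<le> ?R + ennreal ((a - 1) * m powr a)" if "0 < m" for m
  proof -
    have "(\<integral>\<^sup>+x. ennreal (a * m powr (a - 1)) * g x \<partial>M) \<le> (\<integral>\<^sup>+x. epowr (g x) a + ennreal ((a - 1) * m powr a) \<partial>M)"
      by (intro nn_integral_mono epowr_tangent a that)
    then show ?thesis by (simp add: nn_integral_cmult nn_integral_add emeasure_space_1)
  qed
  show ?thesis
  proof (cases "\<integral>\<^sup>+x. g x \<partial>M")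
    case top
    then have "?R = top" using tangent[of 1] a by (auto simp: ennreal_mult_top top_unique)
    then show ?thesis by simp
  next
    case (real m)
    show ?thesis
    proof (cases "m = 0")
      case False
      then have m: "m > 0" using real by simp
      show ?thesis
      proof (cases ?R)
        case (real R)
        have "a * m powr (a - 1) * m \<le> R + (a - 1) * m powr a"
          using tangent[OF m] a real m \<open>(\<integral>\<^sup>+x. g x \<partial>M) = ennreal m\<close>
          by (simp flip: ennreal_plus ennreal_mult)
        moreover have "m powr (a - 1) * m = m powr a" using m by (simp add: powr_diff)
        ultimately have "m powr a \<le> R" by (simp add: algebra_simps)
        then show ?thesis using real m \<open>(\<integral>\<^sup>+x. g x \<partial>M) = ennreal m\<close> by (simp add: ennreal_leI)
      qed simp
    qed (use real in simp)
  qed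
qed

text \<open>Jensen's inequality with respect to the density \<open>k = (G + e) / (S + e)\<close>, where \<open>G t\<close> is the
  \<open>L\<^sup>a\<close>-norm of \<open>H t\<close> and \<open>S\<close> its mean, gives Minkowski's inequality up to \<open>e\<close>.\<close>

lemma minkowski_nn_integral:
  assumes M: "prob_space M" and N: "sigma_finite_measure N"
    and H [measurable]: "case_prod H \<in> borel_measurable (M \<Otimes>\<^sub>M N)" and a: "1 \<le> a"
  shows "epowr (\<integral>\<^sup>+z. epowr (\<integral>\<^sup>+t. H t z \<partial>M) a \<partial>N) (1/a) \<le> (\<integral>\<^sup>+t. epowr (\<integral>\<^sup>+z. epowr (H t z) a \<partial>N) (1/a) \<partial>M)"
    (is "?L \<le> ?S")
proof (cases ?S)
  case (real S)
  interpret M: prob_space M by fact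
  interpret N: sigma_finite_measure N by fact
  interpret MN: pair_sigma_finite M N by unfold_locales
  let ?G = "\<lambda>t. epowr (\<integral>\<^sup>+z. epowr (H t z) a \<partial>N) (1/a)"
  have a0: "0 < a" using a by simp
  show ?thesis
  proof (rule ennreal_le_epsilon)
    fix e :: real assume e: "0 < e"
    \<comment> \<open>The summand e keeps \<open>k\<close> positive where \<open>?G\<close>
      vanishes, so that dividing by \<open>k\<close> is legitimate; the factor normalises
      \<open>k\<close> to a probability density.\<close>
    define k where "k t = (?G t + ennreal e) * ennreal (1 / (S + e))" for t
    have Se: "0 < S + e" using real e by simp
    have [measurable]: "k \<in> borel_measurable M" unfolding k_def by measurable
    have kint: "(\<integral>\<^sup>+t. k t \<partial>M) = 1"
      unfolding k_def using real e Se
      by (simp add: nn_integral_multc nn_integral_add M.emeasure_space_1 flip: ennreal_plus ennreal_mult)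
    have kpos: "k t > 0" for t unfolding k_def using e Se
      by (auto simp: ennreal_zero_less_mult_iff intro: less_le_trans[of 0 "ennreal e"])
    have kfin: "AE t in M. k t < top"
      using nn_integral_noteq_infinite[of k M] kint by (auto simp: top.not_eq_extremum)
    have Gk: "?G t \<le> k t * ennreal (S + e)" for t
    proof -
      have "k t * ennreal (S + e) = ?G t + ennreal e"
        unfolding k_def using Se by (simp add: mult.assoc flip: ennreal_mult)
      then show ?thesis by simp
    qed
    interpret K: prob_space "density M k"
      using kint by (intro prob_spaceI) (simp add: emeasure_density)
    \<comment> \<open>The integral of H is the mean of H / k for the density k, to which Jensen
      applies.\<close>
    have inner: "epowr (\<integral>\<^sup>+t. H t z \<partial>M) a \<le> (\<integral>\<^sup>+t. k t * epowr (H t z / k t) a \<partial>M)" if [measurable]: "z \<in> space N" for z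
    proof -
      have "(\<integral>\<^sup>+t. H t z \<partial>M) = (\<integral>\<^sup>+t. k t * (H t z / k t) \<partial>M)"
        using kfin by (intro nn_integral_cong_AE)
          (auto simp: ennreal_times_divide ennreal_mult_divide_eq mult.commute[of "k _"] kpos[THEN less_imp_neq, symmetric] elim!: eventually_mono)
      also have "\<dots> = (\<integral>\<^sup>+t. H t z / k t \<partial>density M k)" by (simp add: nn_integral_density)
      finally have "epowr (\<integral>\<^sup>+t. H t z \<partial>M) a \<le> (\<integral>\<^sup>+t. epowr (H t z / k t) a \<partial>density M k)"
        using K.jensen_epowr[of "\<lambda>t. H t z / k t", OF _ a] by simp
      then show ?thesis by (simp add: nn_integral_density)
    qed
    have "(\<integral>\<^sup>+z. epowr (\<integral>\<^sup>+t. H t z \<partial>M) a \<partial>N) \<le> (\<integral>\<^sup>+z. (\<integral>\<^sup>+t. k t * epowr (H t z / k t) a \<partial>M) \<partial>N)"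
      by (intro nn_integral_mono inner)
    also have "\<dots> = (\<integral>\<^sup>+t. (\<integral>\<^sup>+z. k t * epowr (H t z / k t) a \<partial>N) \<partial>M)"
      by (rule MN.Fubini') simp
    \<comment> \<open>For fixed t the inner integral is k times (?G / k)^a, and \<open>Gk\<close>
      bounds ?G / k by S + e. Almost everywhere k is finite as well as positive, so the factors k
      cancel.\<close>
    also have "\<dots> \<le> (\<integral>\<^sup>+t. k t * epowr (ennreal (S + e)) a \<partial>M)"
    proof (rule nn_integral_mono_AE)
      show "AE t in M. (\<integral>\<^sup>+z. k t * epowr (H t z / k t) a \<partial>N) \<le> k t * epowr (ennreal (S + e)) a"
        using kfin AE_space
      proof eventually_elim
        case (elim t)
        note [measurable] = \<open>t \<in> space M\<close>
        have "(\<integral>\<^sup>+z. k t * epowr (H t z / k t) a \<partial>N) = k t * epowr (1 / k t) a * (\<integral>\<^sup>+z. epowr (H t z) a \<partial>N)"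
          by (simp add: divide_ennreal_def epowr_mult nn_integral_cmult nn_integral_multc mult_ac)
        also have "(\<integral>\<^sup>+z. epowr (H t z) a \<partial>N) = epowr (?G t) a"
          using a0 by (simp add: epowr_epowr)
        also have "k t * epowr (1 / k t) a * epowr (?G t) a \<le> k t * epowr (1 / k t) a * epowr (k t * ennreal (S + e)) a"
          by (intro mult_left_mono epowr_mono Gk) (use a0 in auto)
        also have "\<dots> = k t * (epowr (1 / k t * k t) a * epowr (ennreal (S + e)) a)"
          by (simp add: epowr_mult mult_ac)
        also have "1 / k t * k t = 1"
          using elim kpos[of t] by (simp add: ennreal_divide_times ennreal_divide_self)
        also have "epowr 1 a = 1" using epowr_ennreal[of 1 a] by simp
        finally show ?case by simp
      qed
    qed
    also have "\<dots> = epowr (ennreal (S + e)) a"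
      by (simp add: nn_integral_multc kint)
    finally have "?L \<le> epowr (epowr (ennreal (S + e)) a) (1/a)"
      using a0 by (intro epowr_mono) auto
    also have "\<dots> = ?S + ennreal e"
      using a0 real e Se by (simp add: epowr_epowr)
    finally show "?L \<le> ?S + ennreal e" .
  qed
qed simp

section \<open>Mixed norms\<close>

text \<open>Reduce \<tau> modulo 2 pi to r in [0, 2 pi), cut the window [r, r + 2 pi) at 2 pi and
  move the excess back by one period. The closed endpoint is a null set.\<close>

lemma nn_integral_periodic_shift:
  fixes g :: "real \<Rightarrow> ennreal"
  assumes [measurable]: "g \<in> borel_measurable borel" and per: "\<And>t. g (t + 2 * pi) = g t"
  shows "(\<integral>\<^sup>+t\<in>{0..2*pi}. g (t + \<tau>) \<partial>lborel) = (\<integral>\<^sup>+t\<in>{0..2*pi}. g t \<partial>lborel)"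
proof -
  have perk: "g (t + 2 * pi * of_nat k) = g t" for t k
  proof (induction k)
    case (Suc k) show ?case using per[of "t + 2 * pi * of_nat k"] Suc by (simp add: algebra_simps)
  qed simp
  have peri: "g (t + 2 * pi * of_int k) = g t" for t k
  proof (cases k)
    case (neg n)
    \<comment> \<open>The case stands for k = -(n + 1), so adding \<open>Suc n\<close> periods leads
      back to t.\<close>
    then have "of_int k = - 1 - real n" by simp
    then have "of_int k + real (Suc n) = 0" by (simp only: of_int_minus of_int_of_nat_eq add.left_inverse)
    moreover have "t + 2 * pi * of_int k + 2 * pi * of_nat (Suc n) = t + 2 * pi * (of_int k + real (Suc n))"
      by (simp only: distrib_left add.assoc)
    ultimately have "t + 2 * pi * of_int k + 2 * pi * of_nat (Suc n) = t" by (simp only: mult_zero_right add_0_right)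
    then show ?thesis using perk[of "t + 2 * pi * of_int k" "Suc n"] by (simp only:)
  qed (simp add: perk)
  define k where "k = \<lfloor>\<tau> / (2 * pi)\<rfloor>"
  define r where "r = \<tau> - 2 * pi * of_int k"
  have "of_int k \<le> \<tau> / (2*pi)" "\<tau> / (2*pi) < of_int k + 1" unfolding k_def by linarith+
  then have r: "0 \<le> r" "r < 2 * pi" unfolding r_def by (auto simp: field_simps)
  have shift: "(\<integral>\<^sup>+t. g (t + b) * indicator S (t + b) \<partial>lborel) = (\<integral>\<^sup>+t. g t * indicator S t \<partial>lborel)"
    if [measurable]: "S \<in> sets borel" for b S
    using nn_integral_real_affine[of "\<lambda>t. g t * indicator S t" 1 b] by (simp add: add.commute)
  have "(\<integral>\<^sup>+t\<in>{0..2*pi}. g (t + \<tau>) \<partial>lborel) = (\<integral>\<^sup>+t. g (t + r) * indicator {r..<r+2*pi} (t + r) \<partial>lborel)"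
  proof (rule nn_integral_cong_AE, use AE_lborel_singleton[of "2 * pi"] in eventually_elim)
    fix t :: real assume "t \<noteq> 2 * pi"
    moreover have "g (t + \<tau>) = g (t + r)" using peri[of "t + r" k] by (simp add: r_def)
    ultimately show "g (t + \<tau>) * indicator {0..2*pi} t = g (t + r) * indicator {r..<r+2*pi} (t + r)"
      by (auto split: split_indicator)
  qed
  also have "\<dots> = (\<integral>\<^sup>+t. g t * indicator {r..<r+2*pi} t \<partial>lborel)" by (rule shift) simp
  also have "\<dots> = (\<integral>\<^sup>+t. g t * indicator {r..<2*pi} t + g t * indicator {2*pi..<2*pi+r} t \<partial>lborel)"
    using r by (intro nn_integral_cong) (auto split: split_indicator)
  also have "\<dots> = (\<integral>\<^sup>+t. g t * indicator {r..<2*pi} t \<partial>lborel) + (\<integral>\<^sup>+t. g t * indicator {2*pi..<2*pi+r} t \<partial>lborel)"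
    by (rule nn_integral_add) auto
  also have "(\<integral>\<^sup>+t. g t * indicator {2*pi..<2*pi+r} t \<partial>lborel) = (\<integral>\<^sup>+t. g (t + 2*pi) * indicator {2*pi..<2*pi+r} (t + 2*pi) \<partial>lborel)"
    by (rule shift[symmetric]) simp
  also have "\<dots> = (\<integral>\<^sup>+t. g t * indicator {0..<r} t \<partial>lborel)"
    by (intro nn_integral_cong) (auto simp: per split: split_indicator)
  also have "(\<integral>\<^sup>+t. g t * indicator {r..<2*pi} t \<partial>lborel) + \<dots> = (\<integral>\<^sup>+t. g t * indicator {r..<2*pi} t + g t * indicator {0..<r} t \<partial>lborel)"
    by (rule nn_integral_add[symmetric]) auto
  also have "\<dots> = (\<integral>\<^sup>+t\<in>{0..2*pi}. g t \<partial>lborel)"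
  proof (rule nn_integral_cong_AE, use AE_lborel_singleton[of "2 * pi"] in eventually_elim)
    fix t :: real assume "t \<noteq> 2 * pi"
    then show "g t * indicator {r..<2*pi} t + g t * indicator {0..<r} t = g t * indicator {0..2*pi} t"
      using r by (auto split: split_indicator)
  qed
  finally show ?thesis .
qed

lemma unit_disc_borel [measurable]: "unit_disc \<in> sets borel"
  by simp

text \<open>The indicator hides the values of f off the disc, which may be non-measurable, and cuts
  the measure down to the disc.\<close>

definition rot_powr :: "real \<Rightarrow> (complex \<Rightarrow> complex) \<Rightarrow> real \<Rightarrow> complex \<Rightarrow> ennreal" where
  "rot_powr p f t z = ennreal (cmod (f (z * cis t)) powr p) * indicator unit_disc z"

definition ray_int :: "real \<Rightarrow> complex measure \<Rightarrow> (complex \<Rightarrow> complex) \<Rightarrow> real \<Rightarrow> ennreal" where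
  "ray_int p \<nu> f t = (\<integral>\<^sup>+z. rot_powr p f t z \<partial>\<nu>)"

text \<open>The q-th power of a mixed norm; the outer root and the normalising constant are restored
  in \<open>mixed_quasinorm\<close>.\<close>

definition mixed_int :: "real \<Rightarrow> real \<Rightarrow> complex measure \<Rightarrow> (complex \<Rightarrow> complex) \<Rightarrow> ennreal" where
  "mixed_int p q \<nu> f = (\<integral>\<^sup>+t\<in>{0..2 * pi}. epowr (ray_int p \<nu> f t) (q / p) \<partial>lborel)"

lemma measurable_rot_powr [measurable (raw)]:
  assumes f: "continuous_on unit_disc f" and [measurable]: "g \<in> borel_measurable M" "h \<in> borel_measurable M"
  shows "(\<lambda>x. rot_powr p f (g x) (h x)) \<in> borel_measurable M"
proof -
  \<comment> \<open>Extension by 0 gives a Borel function on the plane; it may replace f because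
    rotations preserve the disc.\<close>
  define F where "F w = (if w \<in> unit_disc then f w else 0)" for w
  have [measurable]: "F \<in> borel_measurable borel"
    unfolding F_def by (rule borel_measurable_continuous_on_if) (auto intro: f)
  have [measurable]: "cis \<in> borel_measurable borel"
    by (intro borel_measurable_continuous_onI continuous_intros)
  have eq: "rot_powr p f t z = ennreal (cmod (F (z * cis t)) powr p) * indicator unit_disc z" for t z
    by (auto simp: rot_powr_def F_def norm_mult split: split_indicator)
  show ?thesis unfolding eq by measurable
qed

text \<open>Finiteness makes \<open>mixed_int\<close> of bounded functions finite and small for
  small bounds, and supplies the sigma-finiteness for Minkowski and Fubini.\<close>

locale disc_measure = finite_measure \<nu> for \<nu> :: "complex measure" +
  assumes sets_nu [simp, measurable_cong]: "sets \<nu> = sets borel"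
begin

lemma space_nu: "space \<nu> = UNIV"
  using sets_eq_imp_space_eq[OF sets_nu] by simp

lemma emeasure_less_top: "emeasure \<nu> A < top"
  using emeasure_finite[of A] unfolding less_top .

lemma measurable_ray_int:
  assumes [simp]: "continuous_on unit_disc f"
  shows "ray_int p \<nu> f \<in> borel_measurable borel"
  unfolding ray_int_def by measurable

lemma ray_int_periodic: "ray_int p \<nu> f (t + 2 * pi) = ray_int p \<nu> f t"
  unfolding ray_int_def rot_powr_def by (simp add: cis_mult[symmetric])

lemma mixed_int_dilate_le:
  assumes f: "f holomorphic_on unit_disc" and pq: "0 < p" "0 < q" and c: "cmod c \<le> 1"
  shows "mixed_int p q \<nu> (dilate c f) \<le> mixed_int p q \<nu> f"
proof -
  define s where "s = min p q"
  have s: "0 < s" "1 \<le> p / s" "1 \<le> q / s" using pq by (auto simp: s_def min_def field_simps)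
  obtain \<mu> where \<mu>: "prob_space \<mu>" and [simp, measurable_cong]: "sets \<mu> = sets borel" and dom:
    "\<And>w. w \<in> ball 0 1 \<Longrightarrow> ennreal (cmod (f (c * w)) powr s) \<le> (\<integral>\<^sup>+\<tau>. ennreal (cmod (f (w * cis \<tau>)) powr s) \<partial>\<mu>)"
    using dilate_dominated_by_rotations[OF c s(1)] f by metis
  interpret \<mu>: prob_space \<mu> by fact
  interpret P: pair_sigma_finite lborel \<mu> by unfold_locales
  have cf [simp]: "continuous_on unit_disc f" using f by (rule holomorphic_on_imp_continuous_on)
  note [measurable] = measurable_ray_int[OF cf]
  let ?B = "ray_int p \<nu> f"
  have main: "epowr (ray_int p \<nu> (dilate c f) t) (q / p) \<le> (\<integral>\<^sup>+\<tau>. epowr (?B (t + \<tau>)) (q / p) \<partial>\<mu>)" for t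
  proof -
    define H where "H \<tau> z = rot_powr s f (t + \<tau>) z" for \<tau> z
    have Hm [measurable]: "case_prod H \<in> borel_measurable (\<mu> \<Otimes>\<^sub>M \<nu>)"
      unfolding H_def split_beta by measurable
    have HB: "(\<integral>\<^sup>+z. epowr (H \<tau> z) (p / s) \<partial>\<nu>) = ?B (t + \<tau>)" for \<tau>
      unfolding H_def ray_int_def rot_powr_def using s(1) by (intro nn_integral_cong) (auto simp: powr_powr split: split_indicator)
    have "ray_int p \<nu> (dilate c f) t \<le> (\<integral>\<^sup>+z. epowr (\<integral>\<^sup>+\<tau>. H \<tau> z \<partial>\<mu>) (p / s) \<partial>\<nu>)"
      unfolding ray_int_def
    proof (rule nn_integral_mono)
      fix z
      show "rot_powr p (dilate c f) t z \<le> epowr (\<integral>\<^sup>+\<tau>. H \<tau> z \<partial>\<mu>) (p / s)"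
      proof (cases "z \<in> unit_disc")
        case True
        have "ennreal (cmod (dilate c f (z * cis t)) powr p) = epowr (ennreal (cmod (f (c * (z * cis t))) powr s)) (p / s)"
          using s(1) by (simp add: dilate_def powr_powr)
        also have "\<dots> \<le> epowr (\<integral>\<^sup>+\<tau>. ennreal (cmod (f (z * cis t * cis \<tau>)) powr s) \<partial>\<mu>) (p / s)"
          using True s by (intro epowr_mono dom) (auto simp: norm_mult)
        also have "\<dots> = epowr (\<integral>\<^sup>+\<tau>. H \<tau> z \<partial>\<mu>) (p / s)"
          using True by (simp add: H_def rot_powr_def cis_mult[symmetric] mult_ac)
        finally show ?thesis using True by (simp add: rot_powr_def)
      qed (simp add: rot_powr_def)
    qed
    \<comment> \<open>The L^(p/s)-norm of the average is at most the average of the norms; raising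
      to the power q / s and applying Jensen then moves this power inside the average.\<close>
    then have "epowr (ray_int p \<nu> (dilate c f) t) (1 / (p / s)) \<le> epowr (\<integral>\<^sup>+z. epowr (\<integral>\<^sup>+\<tau>. H \<tau> z \<partial>\<mu>) (p / s) \<partial>\<nu>) (1 / (p / s))"
      using s pq by (intro epowr_mono) auto
    also have "\<dots> \<le> (\<integral>\<^sup>+\<tau>. epowr (\<integral>\<^sup>+z. epowr (H \<tau> z) (p / s) \<partial>\<nu>) (1 / (p / s)) \<partial>\<mu>)"
      by (rule minkowski_nn_integral[OF \<mu> sigma_finite_measure_axioms Hm s(2)])
    finally have "epowr (epowr (ray_int p \<nu> (dilate c f) t) (1 / (p / s))) (q / s) \<le> epowr (\<integral>\<^sup>+\<tau>. epowr (?B (t + \<tau>)) (1 / (p / s)) \<partial>\<mu>) (q / s)"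
      unfolding HB using s pq by (intro epowr_mono) auto
    also have "\<dots> \<le> (\<integral>\<^sup>+\<tau>. epowr (epowr (?B (t + \<tau>)) (1 / (p / s))) (q / s) \<partial>\<mu>)"
      by (rule \<mu>.jensen_epowr[OF _ s(3)]) measurable
    finally show ?thesis using s pq by (simp add: epowr_epowr)
  qed
  have "mixed_int p q \<nu> (dilate c f) \<le> (\<integral>\<^sup>+t. (\<integral>\<^sup>+\<tau>. epowr (?B (t + \<tau>)) (q / p) \<partial>\<mu>) * indicator {0..2*pi} t \<partial>lborel)"
    unfolding mixed_int_def by (intro nn_integral_mono mult_right_mono main) auto
  also have "\<dots> = (\<integral>\<^sup>+t. (\<integral>\<^sup>+\<tau>. epowr (?B (t + \<tau>)) (q / p) * indicator {0..2*pi} t \<partial>\<mu>) \<partial>lborel)"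
    by (intro nn_integral_cong nn_integral_multc[symmetric]) measurable
  \<comment> \<open>After the exchange each angle \<tau> contributes the same
    \<open>mixed_int\<close> by periodicity, and \<mu> has total mass 1.\<close>
  also have "\<dots> = (\<integral>\<^sup>+\<tau>. (\<integral>\<^sup>+t. epowr (?B (t + \<tau>)) (q / p) * indicator {0..2*pi} t \<partial>lborel) \<partial>\<mu>)"
    by (rule P.Fubini'[symmetric]) simp
  also have "\<dots> = (\<integral>\<^sup>+\<tau>. mixed_int p q \<nu> f \<partial>\<mu>)"
    unfolding mixed_int_def
    by (intro nn_integral_cong nn_integral_periodic_shift) (simp_all add: ray_int_periodic)
  also have "\<dots> = mixed_int p q \<nu> f" by (simp add: \<mu>.emeasure_space_1)
  finally show ?thesis .
qed

text \<open>\<open>epowr_add_le\<close> is used twice: its constant 2^p for the inner power becomes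
  2^q under the exponent q / p, and the outer power adds 2^(q/p). A pointwise bound on h covers sums
  and differences at once.\<close>

lemma mixed_int_add_le:
  assumes [simp]: "continuous_on unit_disc f" "continuous_on unit_disc g" and pq: "0 < p" "0 < q"
    and h: "\<And>z. z \<in> unit_disc \<Longrightarrow> cmod (h z) \<le> cmod (f z) + cmod (g z)"
  shows "mixed_int p q \<nu> h \<le> ennreal (2 powr q * 2 powr (q / p)) * (mixed_int p q \<nu> f + mixed_int p q \<nu> g)"
proof -
  note [measurable] = measurable_ray_int[OF assms(1)] measurable_ray_int[OF assms(2)]
  have B: "ray_int p \<nu> h t \<le> ennreal (2 powr p) * (ray_int p \<nu> f t + ray_int p \<nu> g t)" for t
  proof -
    have "ray_int p \<nu> h t \<le> (\<integral>\<^sup>+z. ennreal (2 powr p) * (rot_powr p f t z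
      + rot_powr p g t z) \<partial>\<nu>)"
      unfolding ray_int_def
    proof (rule nn_integral_mono)
      fix z
      have "ennreal (cmod (h (z * cis t)) powr p) \<le> ennreal (2 powr p) * (ennreal (cmod (f (z * cis t)) powr p)
          + ennreal (cmod (g (z * cis t)) powr p))" if "z \<in> unit_disc"
      proof -
        have "ennreal (cmod (h (z * cis t)) powr p) = epowr (ennreal (cmod (h (z * cis t)))) p" by simp
        also have "\<dots> \<le> epowr (ennreal (cmod (f (z * cis t))) + ennreal (cmod (g (z * cis t)))) p"
          using that pq h[of "z * cis t"] by (intro epowr_mono) (auto simp: norm_mult ennreal_leI simp flip: ennreal_plus)
        also have "\<dots> \<le> ennreal (2 powr p) * (epowr (ennreal (cmod (f (z * cis t)))) p + epowr (ennreal (cmod (g (z * cis t)))) p)"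
          using pq by (intro epowr_add_le) auto
        finally show ?thesis by simp
      qed
      then show "rot_powr p h t z \<le> ennreal (2 powr p) *
         (rot_powr p f t z + rot_powr p g t z)"
        by (auto simp: rot_powr_def split: split_indicator)
    qed
    also have "\<dots> = ennreal (2 powr p) * (ray_int p \<nu> f t + ray_int p \<nu> g t)"
      unfolding ray_int_def by (simp add: nn_integral_cmult nn_integral_add)
    finally show ?thesis .
  qed
  have "mixed_int p q \<nu> h \<le> (\<integral>\<^sup>+t. ennreal (2 powr q * 2 powr (q / p)) * (epowr (ray_int p \<nu> f t) (q / p) * indicator {0..2*pi} t
      + epowr (ray_int p \<nu> g t) (q / p) * indicator {0..2*pi} t) \<partial>lborel)"
    unfolding mixed_int_def
  proof (rule nn_integral_mono)
    fix t :: real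
    have "epowr (ray_int p \<nu> h t) (q / p) \<le> epowr (ennreal (2 powr p) * (ray_int p \<nu> f t + ray_int p \<nu> g t)) (q / p)"
      using pq by (intro epowr_mono B) auto
    also have "\<dots> = ennreal (2 powr q) * epowr (ray_int p \<nu> f t + ray_int p \<nu> g t) (q / p)"
      using pq by (simp add: epowr_mult powr_powr)
    also have "\<dots> \<le> ennreal (2 powr q) * (ennreal (2 powr (q / p)) * (epowr (ray_int p \<nu> f t) (q / p) + epowr (ray_int p \<nu> g t) (q / p)))"
      using pq by (intro mult_left_mono epowr_add_le) auto
    finally show "epowr (ray_int p \<nu> h t) (q / p) * indicator {0..2*pi} t \<le> ennreal (2 powr q * 2 powr (q / p)) *
      (epowr (ray_int p \<nu> f t) (q / p) * indicator {0..2*pi} t + epowr (ray_int p \<nu> g t) (q / p) * indicator {0..2*pi} t)"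
      by (auto simp: ennreal_mult mult.assoc split: split_indicator)
  qed
  also have "\<dots> = ennreal (2 powr q * 2 powr (q / p)) * (mixed_int p q \<nu> f + mixed_int p q \<nu> g)"
    unfolding mixed_int_def by (simp add: nn_integral_cmult nn_integral_add)
  finally show ?thesis .
qed

lemma disc_measure_restrict:
  assumes [measurable]: "S \<in> sets borel"
  shows "disc_measure (density \<nu> (indicator S))"
proof (intro disc_measure.intro finite_measureI disc_measure_axioms.intro)
  have "emeasure (density \<nu> (indicator S)) (space (density \<nu> (indicator S))) \<le> emeasure \<nu> (space \<nu>)"
    by (simp add: emeasure_density space_nu emeasure_mono)
  then show "emeasure (density \<nu> (indicator S)) (space (density \<nu> (indicator S))) \<noteq> \<infinity>"
    unfolding infinity_ennreal_def by (rule neq_top_trans[OF emeasure_finite])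
qed simp

lemma ray_int_restrict:
  assumes [simp]: "continuous_on unit_disc f" and [measurable]: "S \<in> sets borel"
  shows "ray_int p (density \<nu> (indicator S)) f t =
    (\<integral>\<^sup>+z. rot_powr p f t z * indicator S z \<partial>\<nu>)"
  unfolding ray_int_def by (subst nn_integral_density) (auto simp: mult_ac)

text \<open>The inner integral splits exactly; only the outer power q / p costs a constant.\<close>

lemma mixed_int_split_le:
  assumes [simp]: "continuous_on unit_disc f" and S [measurable]: "S \<in> sets borel" and pq: "0 < p" "0 < q"
  shows "mixed_int p q \<nu> f \<le> ennreal (2 powr (q / p)) *
    (mixed_int p q (density \<nu> (indicator S)) f + mixed_int p q (density \<nu> (indicator (- S))) f)"
proof -
  interpret A: disc_measure "density \<nu> (indicator S)" by (rule disc_measure_restrict) fact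
  interpret B: disc_measure "density \<nu> (indicator (- S))" by (rule disc_measure_restrict) simp
  note [measurable] = A.measurable_ray_int[OF assms(1)] B.measurable_ray_int[OF assms(1)]
  let ?A = "ray_int p (density \<nu> (indicator S)) f" and ?B = "ray_int p (density \<nu> (indicator (- S))) f"
  have eq: "ray_int p \<nu> f t = ?A t + ?B t" for t
  proof -
    have "?A t + ?B t = (\<integral>\<^sup>+z. rot_powr p f t z * indicator S z
      + rot_powr p f t z * indicator (- S) z \<partial>\<nu>)"
      by (simp add: ray_int_restrict nn_integral_add)
    also have "\<dots> = ray_int p \<nu> f t"
      unfolding ray_int_def by (intro nn_integral_cong) (auto split: split_indicator)
    finally show ?thesis ..
  qed
  have "mixed_int p q \<nu> f \<le> (\<integral>\<^sup>+t. ennreal (2 powr (q / p)) * (epowr (?A t) (q / p) * indicator {0..2*pi} t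
      + epowr (?B t) (q / p) * indicator {0..2*pi} t) \<partial>lborel)"
    unfolding mixed_int_def eq
  proof (rule nn_integral_mono)
    fix t :: real
    have "epowr (?A t + ?B t) (q / p) \<le> ennreal (2 powr (q / p)) * (epowr (?A t) (q / p) + epowr (?B t) (q / p))"
      using pq by (intro epowr_add_le) auto
    then show "epowr (?A t + ?B t) (q / p) * indicator {0..2*pi} t \<le> ennreal (2 powr (q / p)) *
        (epowr (?A t) (q / p) * indicator {0..2*pi} t + epowr (?B t) (q / p) * indicator {0..2*pi} t)"
      by (auto split: split_indicator)
  qed
  also have "\<dots> = ennreal (2 powr (q / p)) * (mixed_int p q (density \<nu> (indicator S)) f + mixed_int p q (density \<nu> (indicator (- S))) f)"
    unfolding mixed_int_def by (simp add: nn_integral_cmult nn_integral_add)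
  finally show ?thesis .
qed

lemma mixed_int_bounded:
  assumes [simp]: "continuous_on unit_disc f" and pq: "0 < p" "0 < q"
    and d: "0 \<le> d" "\<And>z. z \<in> unit_disc \<inter> cball 0 R \<Longrightarrow> cmod (f z) \<le> d"
  shows "mixed_int p q (density \<nu> (indicator (cball 0 R))) f \<le>
    ennreal (2 * pi) * epowr (ennreal (d powr p) * emeasure \<nu> UNIV) (q / p)"
proof -
  have "ray_int p (density \<nu> (indicator (cball 0 R))) f t \<le> ennreal (d powr p) * emeasure \<nu> UNIV" for t
  proof -
    have "ray_int p (density \<nu> (indicator (cball 0 R))) f t \<le> (\<integral>\<^sup>+z. ennreal (d powr p) \<partial>\<nu>)"
      unfolding ray_int_restrict[OF assms(1) borel_closed[OF closed_cball]]
    proof (rule nn_integral_mono)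
      fix z
      show "rot_powr p f t z * indicator (cball 0 R) z \<le> ennreal (d powr p)"
        using d(2)[of "z * cis t"] pq by (auto simp: rot_powr_def norm_mult split: split_indicator intro!: ennreal_leI powr_mono2)
    qed
    also have "\<dots> = ennreal (d powr p) * emeasure \<nu> UNIV"
      using sets_eq_imp_space_eq[OF sets_nu] by simp
    finally show ?thesis .
  qed
  then have "mixed_int p q (density \<nu> (indicator (cball 0 R))) f \<le>
     (\<integral>\<^sup>+t. epowr (ennreal (d powr p) * emeasure \<nu> UNIV) (q / p) * indicator {0..2*pi} t \<partial>lborel)"
    unfolding mixed_int_def using pq by (intro nn_integral_mono mult_right_mono epowr_mono) auto
  also have "\<dots> = ennreal (2 * pi) * epowr (ennreal (d powr p) * emeasure \<nu> UNIV) (q / p)"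
    by (subst nn_integral_cmult_indicator) (auto simp: mult.commute)
  finally show ?thesis .
qed

text \<open>Lets \<open>mixed_int_bounded\<close> with R = 1 serve for the unrestricted
  measure.\<close>

lemma mixed_int_restrict_unit:
  assumes "continuous_on unit_disc f"
  shows "mixed_int p q (density \<nu> (indicator (cball 0 1))) f = mixed_int p q \<nu> f"
proof -
  have "ray_int p (density \<nu> (indicator (cball 0 1))) f = ray_int p \<nu> f"
    unfolding fun_eq_iff ray_int_restrict[OF assms borel_closed[OF closed_cball]]
    by (auto simp: ray_int_def rot_powr_def intro!: nn_integral_cong split: split_indicator)
  then show ?thesis by (simp add: mixed_int_def)
qed

text \<open>The expression is a multiple of the bound in \<open>mixed_int_bounded\<close>; it
  vanishes in the limit because the total mass is finite.\<close>

lemma bound_tendsto_zero: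
  assumes pq: "0 < p" "0 < q"
  shows "((\<lambda>d. ennreal C * (ennreal (2 * pi) * epowr (ennreal (d powr p) * emeasure \<nu> UNIV) (q / p))) \<longlongrightarrow> 0) (at_right 0)"
proof -
  note V = emeasure_less_top[of UNIV]
  have "((\<lambda>d::real. d powr p) \<longlongrightarrow> 0 powr p) (at_right 0)"
    using pq by (intro tendsto_powr' tendsto_intros) (auto simp: eventually_at_right_less intro!: eventually_mono[OF eventually_at_right_less])
  then have "((\<lambda>d. ennreal (d powr p)) \<longlongrightarrow> ennreal (0 powr p)) (at_right 0)"
    by (rule tendsto_ennrealI)
  then have "((\<lambda>d. emeasure \<nu> UNIV * ennreal (d powr p)) \<longlongrightarrow> emeasure \<nu> UNIV * ennreal (0 powr p)) (at_right 0)"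
    using V by (intro ennreal_tendsto_cmult)
  then have "((\<lambda>d. epowr (ennreal (d powr p) * emeasure \<nu> UNIV) (q / p)) \<longlongrightarrow> 0) (at_right 0)"
    using pq by (intro tendsto_epowr_zero) (simp_all add: mult.commute)
  then have "((\<lambda>d. ennreal C * (ennreal (2 * pi) * epowr (ennreal (d powr p) * emeasure \<nu> UNIV) (q / p))) \<longlongrightarrow> ennreal C * (ennreal (2*pi) * 0)) (at_right 0)"
    by (intro ennreal_tendsto_cmult) auto
  then show ?thesis by simp
qed

text \<open>Dominated convergence twice: over z for each t with a finite inner integral, which is
  almost every t in the period, and then over t with the full integrand as dominating
  function.\<close>

lemma mixed_int_tail_tendsto_zero:
  assumes cf [simp]: "continuous_on unit_disc f" and pq: "0 < p" "0 < q" and fin: "mixed_int p q \<nu> f < top"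
  shows "(\<lambda>n. mixed_int p q (density \<nu> (indicator (- cball 0 (1 - 1 / real (Suc n))))) f) \<longlonglongrightarrow> 0"
proof -
  let ?S = "\<lambda>n. - cball (0::complex) (1 - 1 / real (Suc n))"
  have S [measurable]: "?S n \<in> sets borel" for n by simp
  let ?B = "\<lambda>n. ray_int p (density \<nu> (indicator (?S n))) f"
  note [measurable] = measurable_ray_int[OF cf]
  have Bm [measurable]: "?B n \<in> borel_measurable borel" for n
    by (rule disc_measure.measurable_ray_int[OF disc_measure_restrict cf]) simp
  have le: "?B n t \<le> ray_int p \<nu> f t" for n t
    unfolding ray_int_restrict[OF cf S] unfolding ray_int_def
    by (intro nn_integral_mono) (auto split: split_indicator)
  have to0: "(\<lambda>n. ?B n t) \<longlonglongrightarrow> 0" if "ray_int p \<nu> f t < top" for t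
  proof -
    have "(\<lambda>n. \<integral>\<^sup>+z. rot_powr p f t z * indicator (?S n) z \<partial>\<nu>) \<longlonglongrightarrow> (\<integral>\<^sup>+z. 0 \<partial>\<nu>)"
    proof (rule nn_integral_dominated_convergence[where w = "\<lambda>z. rot_powr p f t z"])
      show "AE z in \<nu>. (\<lambda>n. rot_powr p f t z * indicator (?S n) z) \<longlonglongrightarrow> 0"
      proof (rule AE_I2)
        fix z :: complex
        show "(\<lambda>n. rot_powr p f t z * indicator (?S n) z) \<longlonglongrightarrow> 0"
        proof (cases "cmod z < 1")
          case True
          have "(\<lambda>n. 1 - 1 / real (Suc n)) \<longlonglongrightarrow> 1 - 0"
            by (intro tendsto_intros LIMSEQ_Suc[OF lim_1_over_n])
          then have "\<forall>\<^sub>F n in sequentially. cmod z < 1 - 1 / real (Suc n)"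
            using True by (intro order_tendstoD) auto
          then have "\<forall>\<^sub>F n in sequentially. rot_powr p f t z * indicator (?S n) z = 0"
            by eventually_elim auto
          then show ?thesis by (rule tendsto_eventually)
        qed (simp add: rot_powr_def)
      qed
    qed (use that in \<open>auto simp: ray_int_def split: split_indicator\<close>)
    then show ?thesis by (simp add: ray_int_restrict)
  qed
  have AEfin: "AE t in lborel. epowr (ray_int p \<nu> f t) (q / p) * indicator {0..2*pi} t \<noteq> \<infinity>"
    using fin by (intro nn_integral_noteq_infinite) (auto simp: mixed_int_def)
  have "(\<lambda>n. \<integral>\<^sup>+t. epowr (?B n t) (q / p) * indicator {0..2*pi} t \<partial>lborel) \<longlonglongrightarrow> (\<integral>\<^sup>+t. 0 \<partial>(lborel :: real measure))"
  proof (rule nn_integral_dominated_convergence[where w = "\<lambda>t. epowr (ray_int p \<nu> f t) (q / p) * indicator {0..2*pi} t"])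
    show "AE t in lborel. (\<lambda>n. epowr (?B n t) (q / p) * indicator {0..2*pi} t) \<longlonglongrightarrow> 0"
      using AEfin
    proof eventually_elim
      case (elim t)
      show ?case
      proof (cases "t \<in> {0..2*pi}")
        case True
        then have "ray_int p \<nu> f t < top" using elim by (simp add: top.not_eq_extremum)
        then show ?thesis using True tendsto_epowr_zero[OF to0, of t "q / p"] pq by simp
      qed simp
    qed
    show "AE t in lborel. epowr (?B n t) (q / p) * indicator {0..2*pi} t \<le> epowr (ray_int p \<nu> f t) (q / p) * indicator {0..2*pi} t" for n
      using pq by (intro AE_I2 mult_right_mono epowr_mono le) auto
    show "(\<lambda>t. epowr (?B n t) (q / p) * indicator {0..2*pi} t) \<in> borel_measurable lborel" for n
      by measurable
  qed (use fin in \<open>auto simp: mixed_int_def\<close>)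
  then show ?thesis by (simp add: mixed_int_def)
qed

end

section \<open>Convergence of dilations and approximation by polynomials\<close>

lemma dilate_holomorphic:
  assumes "f holomorphic_on ball 0 r" "cmod c * r' \<le> r" "0 < r"
  shows "dilate c f holomorphic_on ball 0 r'"
  unfolding dilate_def
proof (rule holomorphic_on_compose_gen[OF _ assms(1), unfolded o_def])
  show "(\<lambda>z. c * z) ` ball 0 r' \<subseteq> ball 0 r"
  proof clarify
    fix z :: complex assume z: "z \<in> ball 0 r'"
    have "cmod c * cmod z < r"
    proof (cases "c = 0")
      case False
      then have "cmod c * cmod z < cmod c * r'" using z by (intro mult_strict_left_mono) auto
      then show ?thesis using assms(2) by simp
    qed (use assms(3) in simp)
    then show "c * z \<in> ball 0 r" by (simp add: norm_mult)
  qed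
qed (intro holomorphic_intros)

text \<open>A radius x strictly between 1 and R bounds the radius of convergence from below, so the
  Taylor series at 0 converges uniformly on the closed unit disc.\<close>

lemma holomorphic_poly_approx:
  assumes g: "g holomorphic_on ball 0 R" and R: "1 < R" and d: "0 < d"
  obtains P where "\<And>z. z \<in> cball 0 1 \<Longrightarrow> cmod (g z - poly P z) < d"
proof -
  define a where "a n = (deriv ^^ n) g 0 / fact n" for n
  have sums: "(\<lambda>n. a n * (w - 0) ^ n) sums g w" if "w \<in> ball 0 R" for w
    unfolding a_def by (rule holomorphic_power_series[OF g that])
  obtain x where x: "1 < x" "x < R" using dense R by blast
  have "summable (\<lambda>n. a n * of_real x ^ n)" using sums[of "of_real x"] x by (auto simp: sums_iff)
  then have "norm (of_real x :: complex) \<le> conv_radius a" by (rule conv_radius_geI)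
  then have "ereal 1 < conv_radius a" using x by (auto intro: less_le_trans[of _ "ereal x"])
  then have "uniform_limit (cball 0 1) (\<lambda>n w. \<Sum>i<n. a i * (w - 0) ^ i) (\<lambda>w. \<Sum>i. a i * (w - 0) ^ i) sequentially"
    by (rule powser_uniform_limit)
  then have "\<forall>\<^sub>F n in sequentially. \<forall>w\<in>cball 0 1. dist (\<Sum>i<n. a i * (w - 0) ^ i) (\<Sum>i. a i * (w - 0) ^ i) < d"
    using d by (rule uniform_limitD)
  then have "\<exists>n. \<forall>w\<in>cball 0 1. dist (\<Sum>i<n. a i * (w - 0) ^ i) (\<Sum>i. a i * (w - 0) ^ i) < d"
    by (rule eventually_happens'[OF sequentially_bot])
  then obtain n where n: "\<And>w. w \<in> cball 0 1 \<Longrightarrow> dist (\<Sum>i<n. a i * (w - 0) ^ i) (\<Sum>i. a i * (w - 0) ^ i) < d"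
    by blast
  have "cmod (g w - poly (\<Sum>i<n. monom (a i) i) w) < d" if "w \<in> cball 0 1" for w
    using n[OF that] sums_unique[OF sums[of w]] that R
    by (simp add: poly_sum poly_monom dist_norm norm_minus_commute)
  then show ?thesis using that by blast
qed

context disc_measure
begin

lemma mixed_int_dilate_tendsto:
  assumes f: "f holomorphic_on unit_disc" and pq: "0 < p" "0 < q" and fin: "mixed_int p q \<nu> f < top"
    and \<zeta>: "\<zeta> \<in> cball 0 1"
  shows "((\<lambda>c. mixed_int p q \<nu> (\<lambda>z. dilate c f z - dilate \<zeta> f z)) \<longlongrightarrow> 0) (at \<zeta> within cball 0 1)"
proof (rule order_tendstoI)
  fix e :: ennreal assume "0 < e"
  \<comment> \<open>The given e may be infinite; a smaller finite bound can be halved as a real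
    number.\<close>
  then obtain e' where e': "0 < e'" "e' < e" using dense by blast
  then obtain e0 where e0: "e' = ennreal e0" "0 < e0"
    by (cases e') (auto simp: top_unique)
  have cf: "continuous_on unit_disc f" using f by (rule holomorphic_on_imp_continuous_on)
  have cd: "continuous_on unit_disc (dilate c f)" if "c \<in> cball 0 1" for c
    using that dilate_holomorphic[OF f, of c 1] by (intro holomorphic_on_imp_continuous_on) auto
  define A where "A = 2 powr (q / p)"
  define B where "B = 2 powr q * 2 powr (q / p)"
  have AB: "0 < A" "0 < B" by (auto simp: A_def B_def)
  define tail where "tail n = mixed_int p q (density \<nu> (indicator (- cball 0 (1 - 1 / real (Suc n))))) f" for n
  \<comment> \<open>The losses on the tail: A from splitting the measure, B from the difference of
    two dilations, and 2 because each of them is bounded by f.\<close>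
  have "(\<lambda>n. ennreal (2 * A * B) * tail n) \<longlonglongrightarrow> ennreal (2 * A * B) * 0"
    unfolding tail_def by (intro ennreal_tendsto_cmult mixed_int_tail_tendsto_zero cf pq fin) auto
  then have "\<forall>\<^sub>F n in sequentially. ennreal (2 * A * B) * tail n < ennreal (e0 / 2)"
    using e0 by (intro order_tendstoD) auto
  then obtain n where n: "ennreal (2 * A * B) * tail n < ennreal (e0 / 2)"
    by (auto simp: eventually_sequentially)
  define R where "R = 1 - 1 / real (Suc n)"
  have R: "0 \<le> R" "R < 1" by (auto simp: R_def)
  have "\<forall>\<^sub>F d in at_right 0. ennreal A * (ennreal (2 * pi) * epowr (ennreal (d powr p) * emeasure \<nu> UNIV) (q / p)) < ennreal (e0 / 2)"
    using e0 by (intro order_tendstoD(2)[OF bound_tendsto_zero[OF pq]]) auto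
  then obtain d where d: "0 < d" and dle: "ennreal A * (ennreal (2 * pi) * epowr (ennreal (d powr p) * emeasure \<nu> UNIV) (q / p)) < ennreal (e0 / 2)"
    using eventually_happens[OF eventually_conj[OF eventually_at_right_less]] trivial_limit_at_right_real by blast
  have "uniformly_continuous_on (cball 0 R) f"
    using R by (intro compact_uniformly_continuous continuous_on_subset[OF cf]) auto
  then obtain \<delta> where \<delta>: "0 < \<delta>" "\<And>x y. x \<in> cball 0 R \<Longrightarrow> y \<in> cball 0 R \<Longrightarrow> dist y x < \<delta> \<Longrightarrow> dist (f y) (f x) < d"
    using d unfolding uniformly_continuous_on_def by metis
  have key: "mixed_int p q \<nu> (\<lambda>z. dilate c f z - dilate \<zeta> f z) < e" if c: "c \<in> cball 0 1" "dist c \<zeta> < \<delta>" for c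
  proof -
    let ?h = "\<lambda>z. dilate c f z - dilate \<zeta> f z"
    let ?T = "density \<nu> (indicator (- cball 0 R))"
    have ch: "continuous_on unit_disc ?h" using cd c \<zeta> by (intro continuous_intros) auto
    interpret T: disc_measure ?T by (rule disc_measure_restrict) simp
    have "mixed_int p q (density \<nu> (indicator (cball 0 R))) ?h \<le>
        ennreal (2 * pi) * epowr (ennreal (d powr p) * emeasure \<nu> UNIV) (q / p)"
    proof (rule mixed_int_bounded[OF ch pq])
      \<comment> \<open>Multiplication by c or \<zeta> maps \<open>cball 0 R\<close> into itself, so
        uniform continuity on this compact ball suffices.\<close>
      fix z assume z: "z \<in> unit_disc \<inter> cball 0 R"
      have in_R: "b * z \<in> cball 0 R" if "b \<in> cball 0 1" for b
        using mult_mono[of "cmod b" 1 "cmod z" R] that z by (simp add: norm_mult)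
      have "dist (c * z) (\<zeta> * z) = dist c \<zeta> * cmod z"
        by (simp add: dist_norm norm_mult flip: left_diff_distrib)
      also have "\<dots> \<le> dist c \<zeta> * 1" using z by (intro mult_left_mono) auto
      finally have "dist (f (c * z)) (f (\<zeta> * z)) < d"
        using c \<zeta> by (intro \<delta> in_R) auto
      then show "cmod (?h z) \<le> d" by (simp add: dilate_def dist_norm)
    qed (use d in simp)
    then have 1: "ennreal A * mixed_int p q (density \<nu> (indicator (cball 0 R))) ?h < ennreal (e0 / 2)"
      by (rule order.strict_trans1[OF mult_left_mono dle]) simp
    have "mixed_int p q ?T ?h \<le> ennreal B * (mixed_int p q ?T (dilate c f) + mixed_int p q ?T (dilate \<zeta> f))"
      unfolding B_def using c \<zeta> by (intro T.mixed_int_add_le cd pq norm_triangle_ineq4) auto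
    also have "\<dots> \<le> ennreal B * (mixed_int p q ?T f + mixed_int p q ?T f)"
      using c \<zeta> by (intro mult_left_mono add_mono T.mixed_int_dilate_le f pq) auto
    also have "\<dots> = ennreal (2 * B) * tail n"
      using AB by (simp add: tail_def R_def ennreal_mult mult_2[symmetric] mult_ac)
    finally have "ennreal A * mixed_int p q ?T ?h \<le> ennreal A * (ennreal (2 * B) * tail n)"
      by (rule mult_left_mono) simp
    also have "\<dots> = ennreal (2 * A * B) * tail n"
      using AB by (simp add: ennreal_mult mult_ac)
    finally have 2: "ennreal A * mixed_int p q ?T ?h < ennreal (e0 / 2)" using n by simp
    have "mixed_int p q \<nu> ?h \<le> ennreal A * (mixed_int p q (density \<nu> (indicator (cball 0 R))) ?h + mixed_int p q ?T ?h)"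
      unfolding A_def by (intro mixed_int_split_le ch pq) simp
    also have "\<dots> = ennreal A * mixed_int p q (density \<nu> (indicator (cball 0 R))) ?h + ennreal A * mixed_int p q ?T ?h"
      by (rule distrib_left)
    also have "\<dots> \<le> ennreal (e0 / 2) + ennreal (e0 / 2)"
      using 1 2 by (intro add_mono) auto
    also have "\<dots> = e'" using e0 by (simp flip: ennreal_plus)
    finally show ?thesis using e' by simp
  qed
  show "\<forall>\<^sub>F c in at \<zeta> within cball 0 1. mixed_int p q \<nu> (\<lambda>z. dilate c f z - dilate \<zeta> f z) < e"
    unfolding eventually_at using \<delta>(1) key by blast
qed simp

lemma mixed_int_poly_approx:
  assumes f: "f holomorphic_on unit_disc" and pq: "0 < p" "0 < q" and fin: "mixed_int p q \<nu> f < top" and "0 < e"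
  obtains P where "mixed_int p q \<nu> (\<lambda>z. f z - poly P z) < e"
proof -
  obtain e' where e': "0 < e'" "e' < e" using dense \<open>0 < e\<close> by blast
  then obtain e0 where e0: "e' = ennreal e0" "0 < e0"
    by (cases e') (auto simp: top_unique)
  have cf: "continuous_on unit_disc f" using f by (rule holomorphic_on_imp_continuous_on)
  define B where "B = 2 powr q * 2 powr (q / p)"
  \<comment> \<open>The second \<open>Suc\<close> keeps \<open>X n\<close> away from 0, so that the
    radius 1 / |X n| used below makes sense; X n < 1 keeps it off the limit point, as convergence
    within the closed disc requires.\<close>
  define X where "X n = complex_of_real (1 - 1 / real (Suc (Suc n)))" for n
  have X: "cmod (X n) < 1" for n unfolding X_def norm_of_real by (simp add: field_simps)
  have "(\<lambda>n. 1 - 1 / real (Suc (Suc n))) \<longlonglongrightarrow> 1 - 0"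
    by (intro tendsto_intros LIMSEQ_Suc[OF LIMSEQ_Suc[OF lim_1_over_n]])
  then have "X \<longlonglongrightarrow> complex_of_real (1 - 0)" unfolding X_def by (rule tendsto_of_real)
  then have "X \<longlonglongrightarrow> 1" by simp
  moreover have "X n \<in> cball 0 1 - {1}" for n using X[of n] by auto
  moreover have "((\<lambda>c. mixed_int p q \<nu> (\<lambda>z. dilate c f z - dilate 1 f z)) \<longlongrightarrow> 0) (at 1 within cball 0 1)"
    by (rule mixed_int_dilate_tendsto[OF f pq fin]) simp
  ultimately have "((\<lambda>c. mixed_int p q \<nu> (\<lambda>z. dilate c f z - dilate 1 f z)) \<circ> X) \<longlonglongrightarrow> 0"
    unfolding tendsto_at_iff_sequentially by blast
  then have "(\<lambda>n. mixed_int p q \<nu> (\<lambda>z. dilate (X n) f z - f z)) \<longlonglongrightarrow> 0"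
    by (simp add: o_def dilate_def)
  then have "(\<lambda>n. ennreal B * mixed_int p q \<nu> (\<lambda>z. dilate (X n) f z - f z)) \<longlonglongrightarrow> ennreal B * 0"
    by (intro ennreal_tendsto_cmult) simp_all
  then have "\<forall>\<^sub>F n in sequentially. ennreal B * mixed_int p q \<nu> (\<lambda>z. dilate (X n) f z - f z) < ennreal (e0 / 2)"
    using e0 by (intro order_tendstoD) auto
  then obtain n where n: "ennreal B * mixed_int p q \<nu> (\<lambda>z. dilate (X n) f z - f z) < ennreal (e0 / 2)"
    by (auto simp: eventually_sequentially)
  let ?g = "dilate (X n) f"
  have X0: "X n \<noteq> 0" unfolding X_def of_real_eq_0_iff by (simp add: field_simps)
  \<comment> \<open>The dilated function is analytic on a disc of radius greater than 1, where
    Taylor approximation is uniform up to the unit circle.\<close>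
  have g: "?g holomorphic_on ball 0 (1 / cmod (X n))"
    using X0 by (intro dilate_holomorphic[OF f]) auto
  have gR: "1 < 1 / cmod (X n)" using X0 X[of n] by simp
  have cg: "continuous_on unit_disc ?g"
    using gR by (intro holomorphic_on_imp_continuous_on holomorphic_on_subset[OF g]) auto
  have "\<forall>\<^sub>F d in at_right 0. ennreal B * (ennreal (2 * pi) * epowr (ennreal (d powr p) * emeasure \<nu> UNIV) (q / p)) < ennreal (e0 / 2)"
    using e0 by (intro order_tendstoD(2)[OF bound_tendsto_zero[OF pq]]) auto
  then obtain d where d: "0 < d" and dle: "ennreal B * (ennreal (2 * pi) * epowr (ennreal (d powr p) * emeasure \<nu> UNIV) (q / p)) < ennreal (e0 / 2)"
    using eventually_happens[OF eventually_conj[OF eventually_at_right_less]] trivial_limit_at_right_real by blast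
  obtain P where P: "\<And>z. z \<in> cball 0 1 \<Longrightarrow> cmod (?g z - poly P z) < d"
    using holomorphic_poly_approx[OF g gR d] by blast
  have cp: "continuous_on unit_disc (\<lambda>z. ?g z - poly P z)" by (intro continuous_intros cg)
  have "mixed_int p q \<nu> (\<lambda>z. ?g z - poly P z) \<le> ennreal (2 * pi) * epowr (ennreal (d powr p) * emeasure \<nu> UNIV) (q / p)"
    unfolding mixed_int_restrict_unit[OF cp, symmetric] using P d
    by (intro mixed_int_bounded cp pq) (auto intro: less_imp_le)
  then have 1: "ennreal B * mixed_int p q \<nu> (\<lambda>z. ?g z - poly P z) < ennreal (e0 / 2)"
    by (rule order.strict_trans1[OF mult_left_mono dle]) simp
  have "mixed_int p q \<nu> (\<lambda>z. f z - poly P z) \<le> ennreal B * (mixed_int p q \<nu> (\<lambda>z. ?g z - f z) + mixed_int p q \<nu> (\<lambda>z. ?g z - poly P z))"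
    unfolding B_def
  proof (intro mixed_int_add_le pq cp continuous_intros cg cf)
    show "cmod (f z - poly P z) \<le> cmod (?g z - f z) + cmod (?g z - poly P z)" for z
      using norm_triangle_ineq4[of "?g z - poly P z" "?g z - f z"] by simp
  qed
  also have "\<dots> = ennreal B * mixed_int p q \<nu> (\<lambda>z. ?g z - f z) + ennreal B * mixed_int p q \<nu> (\<lambda>z. ?g z - poly P z)"
    by (rule distrib_left)
  also have "\<dots> \<le> ennreal (e0 / 2) + ennreal (e0 / 2)"
    using 1 n by (intro add_mono) auto
  also have "\<dots> = e'" using e0 by (simp flip: ennreal_plus)
  finally show ?thesis using e' that[of P] by simp
qed

lemma mixed_int_poly_finite:
  assumes pq: "0 < p" "0 < q"
  shows "mixed_int p q \<nu> (poly P) < top"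
proof -
  have "bounded (poly P ` cball 0 1)"
    by (intro compact_imp_bounded compact_continuous_image continuous_intros) auto
  then obtain d where d: "0 < d" "\<And>z. z \<in> cball 0 1 \<Longrightarrow> cmod (poly P z) \<le> d"
    unfolding bounded_pos by auto
  have c: "continuous_on unit_disc (poly P)" by (intro continuous_intros)
  have "mixed_int p q \<nu> (poly P) \<le> ennreal (2 * pi) * epowr (ennreal (d powr p) * emeasure \<nu> UNIV) (q / p)"
    unfolding mixed_int_restrict_unit[OF c, symmetric] using d
    by (intro mixed_int_bounded c pq) auto
  also have "\<dots> < top"
    by (simp add: ennreal_mult_less_top emeasure_less_top)
  finally show ?thesis .
qed

end

text \<open>The common form of both quasinorms. The constant K is 1 / (2 pi) for L and 1 for T,
  where the area factor 1 / pi is put into the measure. Continuity of f is what makes the rotated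
  integrands Borel measurable.\<close>

locale mixed_quasinorm = disc_measure +
  fixes p q K :: real and N :: "(complex \<Rightarrow> complex) \<Rightarrow> ennreal"
  assumes pq: "0 < p" "0 < q" and K: "0 < K"
    and N: "continuous_on unit_disc f \<Longrightarrow> N f = epowr (ennreal K * mixed_int p q \<nu> f) (1 / q)"
begin

lemma N_finite_iff: "continuous_on unit_disc f \<Longrightarrow> N f < top \<longleftrightarrow> mixed_int p q \<nu> f < top"
  unfolding N epowr_less_top ennreal_mult_less_top using K by auto

lemma N_dilate_le:
  assumes f: "f holomorphic_on unit_disc" and c: "c \<in> cball 0 1"
  shows "N (dilate c f) \<le> N f"
proof -
  have "dilate c f holomorphic_on unit_disc" using c by (intro dilate_holomorphic[OF f]) auto
  then show ?thesis
    using f c pq by (auto simp: N holomorphic_on_imp_continuous_on intro!: epowr_mono mult_left_mono mixed_int_dilate_le)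
qed

lemma N_dilate_tendsto:
  assumes f: "f holomorphic_on unit_disc" and fin: "N f < top" and \<zeta>: "\<zeta> \<in> cball 0 1"
  shows "((\<lambda>c. N (\<lambda>z. dilate c f z - dilate \<zeta> f z)) \<longlongrightarrow> 0) (at \<zeta> within cball 0 1)"
proof -
  have cf: "continuous_on unit_disc f" using f by (rule holomorphic_on_imp_continuous_on)
  have cd: "continuous_on unit_disc (dilate c f)" if "c \<in> cball 0 1" for c
    using that dilate_holomorphic[OF f, of c 1] by (intro holomorphic_on_imp_continuous_on) auto
  have "((\<lambda>c. ennreal K * mixed_int p q \<nu> (\<lambda>z. dilate c f z - dilate \<zeta> f z)) \<longlongrightarrow> ennreal K * 0) (at \<zeta> within cball 0 1)"
    using fin N_finite_iff[OF cf] by (intro ennreal_tendsto_cmult mixed_int_dilate_tendsto f pq \<zeta>) auto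
  then have "((\<lambda>c. epowr (ennreal K * mixed_int p q \<nu> (\<lambda>z. dilate c f z - dilate \<zeta> f z)) (1 / q)) \<longlongrightarrow> 0) (at \<zeta> within cball 0 1)"
    using pq by (intro tendsto_epowr_zero) auto
  \<comment> \<open>The formula for \<open>N\<close> is available only for functions continuous on
    the disc, hence for c in the closed disc, which the filter guarantees.\<close>
  moreover have "\<forall>\<^sub>F c in at \<zeta> within cball 0 1. epowr (ennreal K * mixed_int p q \<nu> (\<lambda>z. dilate c f z - dilate \<zeta> f z)) (1 / q)
      = N (\<lambda>z. dilate c f z - dilate \<zeta> f z)"
    unfolding eventually_at_filter
  proof (intro always_eventually allI impI)
    fix c :: complex assume "c \<in> cball 0 1"
    then have "continuous_on unit_disc (\<lambda>z. dilate c f z - dilate \<zeta> f z)"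
      by (intro continuous_on_diff cd \<zeta>)
    then show "epowr (ennreal K * mixed_int p q \<nu> (\<lambda>z. dilate c f z - dilate \<zeta> f z)) (1 / q)
      = N (\<lambda>z. dilate c f z - dilate \<zeta> f z)"
      by (rule N[symmetric])
  qed
  ultimately show ?thesis by (rule Lim_transform_eventually)
qed

lemma N_poly_finite: "N (poly P) < top"
  by (subst N_finite_iff) (auto intro!: continuous_intros mixed_int_poly_finite pq)

lemma N_poly_approx:
  assumes f: "f holomorphic_on unit_disc" and fin: "N f < top" and e: "0 < e"
  obtains P where "N (\<lambda>z. f z - poly P z) < ennreal e"
proof -
  have cf: "continuous_on unit_disc f" using f by (rule holomorphic_on_imp_continuous_on)
  \<comment> \<open>The threshold is chosen so that multiplication by K and the root 1 / q give e /
    2; the half restores strict inequality.\<close>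
  have "0 < ennreal ((e / 2) powr q / K)" using e K by simp
  then obtain P where P: "mixed_int p q \<nu> (\<lambda>z. f z - poly P z) < ennreal ((e / 2) powr q / K)"
    by (rule mixed_int_poly_approx[OF f pq fin[unfolded N_finite_iff[OF cf]]])
  have "N (\<lambda>z. f z - poly P z) = epowr (ennreal K * mixed_int p q \<nu> (\<lambda>z. f z - poly P z)) (1 / q)"
    by (intro N continuous_intros cf)
  also have "\<dots> \<le> epowr (ennreal K * ennreal ((e / 2) powr q / K)) (1 / q)"
    using P pq by (intro epowr_mono mult_left_mono) auto
  also have "\<dots> = ennreal (e / 2)"
    using K e pq by (simp add: powr_powr flip: ennreal_mult)
  also have "\<dots> < ennreal e" using e by (simp add: ennreal_lessI)
  finally show ?thesis using that by blast
qed

end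

section \<open>Lebesgue measure and radial weights\<close>

lemma linear_isometry_image_ball:
  fixes f :: "'a::euclidean_space \<Rightarrow> 'a"
  assumes "linear f" "\<And>x. norm (f x) = norm x"
  shows "f ` ball x r = ball (f x) r" and "bij f"
proof -
  have inj: "inj f"
    using assms by (metis linear_injective_0 norm_eq_zero)
  then show bij: "bij f"
    using linear_injective_imp_surjective[OF assms(1)] by (simp add: bij_def)
  have dist: "dist (f x) (f y) = dist x y" for x y
    using assms by (metis dist_norm linear_diff)
  show "f ` ball x r = ball (f x) r"
  proof
    show "ball (f x) r \<subseteq> f ` ball x r"
    proof
      fix y assume "y \<in> ball (f x) r"
      moreover obtain z where "y = f z" using bij by (metis bij_pointE)
      ultimately show "y \<in> f ` ball x r" by (simp add: dist)
    qed
  qed (auto simp: dist)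
qed

text \<open>By Vitali, an open set is a countable disjoint union of balls up to a null set.\<close>

lemma lborel_distr_linear_isometry:
  fixes f :: "'a::euclidean_space \<Rightarrow> 'a"
  assumes lin: "linear f" and norm: "\<And>x. norm (f x) = norm x"
  shows "distr lborel borel f = lborel"
proof (rule lborel_eqI[symmetric])
  have cont: "continuous_on UNIV f"
    using lin by (simp add: linear_continuous_on linear_conv_bounded_linear)
  have [measurable]: "f \<in> borel_measurable borel"
    by (intro borel_measurable_continuous_onI cont)
  note ball = linear_isometry_image_ball(1)[OF lin norm]
  have bij: "bij f" by (rule linear_isometry_image_ball(2)[OF lin norm])
  fix l u :: 'a assume lu: "\<And>b. b \<in> Basis \<Longrightarrow> l \<bullet> b \<le> u \<bullet> b"
  \<comment> \<open>As f maps V onto the box, it remains to show that f preserves the volume of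
    V.\<close>
  define V where "V = f -` box l u"
  have V: "open V" unfolding V_def by (rule open_vimage[OF open_box cont])
  have fV: "f ` V = box l u" unfolding V_def using bij by (simp add: bij_is_surj surj_image_vimage_eq)
  define K where "K = {(x, r). x \<in> V \<and> 0 < r \<and> ball x r \<subseteq> V}"
  obtain C where C: "countable C" "C \<subseteq> K"
    "pairwise (\<lambda>i j. disjnt (ball (fst i) (snd i)) (ball (fst j) (snd j))) C"
    "negligible (V - (\<Union>i\<in>C. ball (fst i) (snd i)))"
  proof (rule Vitali_covering_theorem_balls[of V K fst snd])
    fix x d assume x: "x \<in> V" "(0::real) < d"
    obtain e where e: "0 < e" "ball x e \<subseteq> V" using V x(1) open_contains_ball by blast
    then show "\<exists>i. i \<in> K \<and> x \<in> ball (fst i) (snd i) \<and> snd i < d"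
      using x by (intro exI[of _ "(x, min e (d / 2))"]) (auto simp: K_def)
  qed
  define N where "N = V - (\<Union>i\<in>C. ball (fst i) (snd i))"
  have "\<And>i. i \<in> C \<Longrightarrow> ball (fst i) (snd i) \<subseteq> V" using C(2) by (force simp: K_def)
  then have Vdec: "V = (\<Union>i\<in>C. ball (fst i) (snd i)) \<union> N" by (auto simp: N_def)
  have ballC: "\<And>i. i \<in> C \<Longrightarrow> 0 \<le> snd i" using C(2) by (auto simp: K_def)
  have fVdec: "box l u = (\<Union>i\<in>C. ball (f (fst i)) (snd i)) \<union> f ` N"
    unfolding fV[symmetric] by (subst Vdec) (simp add: image_Un image_UN ball)
  have "f differentiable_on N"
    using lin by (simp add: linear_imp_differentiable_on)
  then have "negligible (f ` N)"
    using C(4) by (intro negligible_differentiable_image_negligible) (auto simp: N_def)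
  then have nul: "N \<in> null_sets lebesgue" "f ` N \<in> null_sets lebesgue"
    using C(4) by (auto simp: N_def negligible_iff_null_sets)
  \<comment> \<open>Only the radii enter the right-hand side, so V and its image, decomposed with
    centres x and f x, have the same measure.\<close>
  have main: "emeasure lebesgue ((\<Union>i\<in>C. ball (a i) (snd i)) \<union> M) = (\<integral>\<^sup>+i. ennreal (unit_ball_vol (DIM('a)) * snd i ^ DIM('a)) \<partial>count_space C)"
    if "M \<in> null_sets lebesgue" "disjoint_family_on (\<lambda>i. ball (a i) (snd i)) C" for M and a :: "'a \<times> real \<Rightarrow> 'a"
  proof -
    have S: "(\<Union>i\<in>C. ball (a i) (snd i)) \<in> sets lborel"
      unfolding sets_lborel by (intro borel_open open_UN) auto
    then have "emeasure lebesgue ((\<Union>i\<in>C. ball (a i) (snd i)) \<union> M) = emeasure lebesgue (\<Union>i\<in>C. ball (a i) (snd i))"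
      by (intro emeasure_Un_null_set that sets_completionI_sets)
    also have "\<dots> = emeasure lborel (\<Union>i\<in>C. ball (a i) (snd i))" using S by simp
    also have "\<dots> = (\<integral>\<^sup>+i. emeasure lborel (ball (a i) (snd i)) \<partial>count_space C)"
      by (intro emeasure_UN_countable C that) auto
    also have "\<dots> = (\<integral>\<^sup>+i. ennreal (unit_ball_vol (DIM('a)) * snd i ^ DIM('a)) \<partial>count_space C)"
      by (intro nn_integral_cong) (simp add: emeasure_ball ballC)
    finally show ?thesis .
  qed
  have d1: "disjoint_family_on (\<lambda>i. ball (fst i) (snd i)) C"
    using C(3) by (auto simp: disjoint_family_on_def pairwise_def disjnt_def)
  then have d2: "disjoint_family_on (\<lambda>i. ball (f (fst i)) (snd i)) C"
    unfolding disjoint_family_on_def ball[symmetric] using bij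
    by (metis bij_is_inj image_Int image_empty)
  have "emeasure lebesgue V = emeasure lebesgue (box l u)"
    unfolding fVdec by (subst Vdec) (simp only: main[OF nul(1) d1] main[OF nul(2) d2])
  then have "emeasure lborel V = emeasure lborel (box l u)"
    using V by simp
  moreover have "emeasure (distr lborel borel f) (box l u) = emeasure lborel V"
    by (simp add: emeasure_distr V_def)
  ultimately show "emeasure (distr lborel borel f) (box l u) = (\<Prod>b\<in>Basis. (u - l) \<bullet> b)"
    using lu by (simp add: emeasure_lborel_box_eq)
qed simp

lemma lborel_distr_rotation: "distr lborel borel (\<lambda>z. z * cis t) = lborel"
  by (rule lborel_distr_linear_isometry)
    (auto simp: norm_mult intro!: bounded_linear.linear bounded_linear_mult_left)

text \<open>Polar coordinates for radial functions: half-lines determine both measures, and the area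
  pi a^2 of a disc has derivative 2 pi a.\<close>

lemma lborel_distr_cmod:
  "distr lborel borel cmod = density lborel (\<lambda>r. ennreal (2 * pi * r) * indicator {0..} r)"
proof (rule measure_eqI_generator_eq[where E = "range (\<lambda>a::real. {..a})" and A = "\<lambda>n. {..real n}" and \<Omega> = UNIV])
  have M1: "emeasure (distr lborel borel cmod) {..a} = ennreal (if 0 \<le> a then pi * a\<^sup>2 else 0)" for a
  proof -
    have "emeasure (distr lborel borel cmod) {..a} = emeasure lborel (cball (0::complex) a)"
      by (subst emeasure_distr) (auto intro!: arg_cong[where f = "emeasure lborel"])
    also have "\<dots> = ennreal (if 0 \<le> a then pi * a\<^sup>2 else 0)"
      by (simp add: emeasure_cball unit_ball_vol_2)
    finally show ?thesis .
  qed
  fix X assume "X \<in> range (\<lambda>a::real. {..a})"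
  then obtain a where X: "X = {..a}" by blast
  have "emeasure (density lborel (\<lambda>r. ennreal (2 * pi * r) * indicator {0..} r)) {..a}
      = (\<integral>\<^sup>+r. ennreal (2 * pi * r) * indicator {0..a} r \<partial>lborel)"
    by (subst emeasure_density) (auto intro!: nn_integral_cong split: split_indicator)
  also have "\<dots> = ennreal (if 0 \<le> a then pi * a\<^sup>2 else 0)"
  proof (cases "0 \<le> a")
    case True
    have "(\<integral>\<^sup>+r. ennreal (2 * pi * r) * indicator {0..a} r \<partial>lborel) = ennreal (pi * a\<^sup>2 - pi * 0\<^sup>2)"
      using True by (intro nn_integral_FTC_Icc) (auto intro!: derivative_eq_intros)
    then show ?thesis using True by simp
  qed simp
  finally show "emeasure (distr lborel borel cmod) X = emeasure (density lborel (\<lambda>r. ennreal (2 * pi * r) * indicator {0..} r)) X"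
    unfolding X by (simp add: M1)
next
  have "emeasure (distr lborel borel cmod) {..real n} = emeasure lborel (cball (0::complex) n)" for n
    by (subst emeasure_distr) (auto intro!: arg_cong[where f = "emeasure lborel"])
  then show "emeasure (distr lborel borel cmod) {..real n} \<noteq> \<infinity>" for n
    by (simp add: emeasure_cball)
next
  show "(\<Union>n. {..real n}) = UNIV" using real_arch_simple by auto
next
  show "Int_stable (range (\<lambda>a::real. {..a}))" by (auto simp: Int_stable_def min_def intro!: exI[of _ "min _ _"])
qed (auto simp: borel_eq_atMost)

lemma nn_integral_radial:
  assumes [measurable]: "g \<in> borel_measurable borel"
  shows "(\<integral>\<^sup>+z. g (cmod z) \<partial>lborel) = (\<integral>\<^sup>+r\<in>{0..}. ennreal (2 * pi * r) * g r \<partial>lborel)"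
proof -
  have "(\<integral>\<^sup>+z. g (cmod z) \<partial>lborel) = (\<integral>\<^sup>+r. g r \<partial>distr lborel borel cmod)"
    by (subst nn_integral_distr) auto
  also have "\<dots> = (\<integral>\<^sup>+r\<in>{0..}. ennreal (2 * pi * r) * g r \<partial>lborel)"
    unfolding lborel_distr_cmod by (subst nn_integral_density) (auto simp: mult_ac)
  finally show ?thesis .
qed

text \<open>Closed sets are cut by balls into compact pieces, whose continuous images are
  compact.\<close>

lemma fsigma_cmod_image:
  assumes "fsigma C" shows "cmod ` C \<in> sets borel"
  using assms
proof cases
  case (1 F)
  have eq: "cmod ` C = (\<Union>n. \<Union>k. cmod ` (F n \<inter> cball 0 (real k)))"
    unfolding 1 using real_arch_simple by fastforce
  have "cmod ` (F n \<inter> cball 0 (real k)) \<in> sets borel" for n k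
    using 1 by (intro borel_compact compact_continuous_image closed_Int_compact continuous_intros) auto
  then have "(\<Union>k. cmod ` (F n \<inter> cball 0 (real k))) \<in> sets borel" for n
    by (intro sets.countable_nat_UN) auto
  then show ?thesis unfolding eq by (intro sets.countable_nat_UN) auto
qed

text \<open>The moduli of the closed pieces of a radial set and of its complement sandwich the profile
  between Borel sets.\<close>

lemma lebesgue_radial_profile:
  fixes E :: "real set"
  assumes E: "E \<subseteq> {0..}" and S: "{z. cmod z \<in> E} \<in> sets lebesgue"
  shows "E \<in> sets lebesgue"
proof -
  obtain C T where C: "fsigma C" "T \<in> null_sets lebesgue" "C \<union> T = {z. cmod z \<in> E}"
    using lebesgue_set_almost_fsigma[OF S] by metis
  have "- {z. cmod z \<in> E} \<in> sets lebesgue"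
    using S by (simp add: Compl_in_sets_lebesgue)
  then obtain C' T' where C': "fsigma C'" "T' \<in> null_sets lebesgue" "C' \<union> T' = - {z. cmod z \<in> E}"
    using lebesgue_set_almost_fsigma by metis
  define F where "F = cmod ` C"
  define G where "G = {0..} - cmod ` C'"
  have [measurable]: "F \<in> sets borel" "G \<in> sets borel"
    unfolding F_def G_def using fsigma_cmod_image C C' by auto
  have FE: "F \<subseteq> E" using C(3) by (auto simp: F_def)
  have EG: "E \<subseteq> G" using C'(3) E by (auto simp: G_def)
  \<comment> \<open>A point whose modulus lies in \<open>G - F\<close> belongs to neither
    \<open>C\<close> nor \<open>C'\<close>, so it is in one of the two null remainders.\<close>
  have "{z. cmod z \<in> G - F} \<subseteq> T \<union> T'" using C(3) C'(3) by (auto simp: F_def G_def)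
  moreover have "T \<union> T' \<in> null_sets lebesgue" using C(2) C'(2) by blast
  ultimately have "{z. cmod z \<in> G - F} \<in> null_sets lebesgue"
    using null_sets_completion_subset by blast
  moreover have mz: "{z. cmod z \<in> G - F} \<in> sets lborel" by measurable
  ultimately have "emeasure lborel {z. cmod z \<in> G - F} = 0"
    using emeasure_completion[of "{z. cmod z \<in> G - F}" lborel] by (simp add: null_sets_def)
  then have "emeasure (distr lborel borel cmod) (G - F) = 0"
    by (subst emeasure_distr) (auto simp: vimage_def)
  then have 0: "(\<integral>\<^sup>+r. ennreal (2 * pi * r) * indicator {0..} r * indicator (G - F) r \<partial>lborel) = 0"
    unfolding lborel_distr_cmod by (subst (asm) emeasure_density) auto
  have [simp]: "\<not> pi \<le> 0" using pi_gt_zero by linarith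
  from 0 have "AE r in lborel. ennreal (2 * pi * r) * indicator {0..} r * indicator (G - F) r = 0"
    by (subst (asm) nn_integral_0_iff_AE) auto
  \<comment> \<open>On the nonnegative axis the density 2 pi r vanishes only at 0, a single null
    point.\<close>
  then have "AE r in lborel. r \<notin> G - F"
    using AE_lborel_singleton[of 0]
    by eventually_elim (auto simp: G_def ennreal_eq_0_iff mult_le_0_iff split: split_indicator_asm)
  then have "G - F \<in> null_sets lborel" by (subst (asm) AE_iff_null_sets[symmetric]) auto
  then have "E - F \<in> null_sets lebesgue"
    using EG null_sets_completion_subset[of "E - F" "G - F"] null_sets_completionI by blast
  then have "F \<union> (E - F) \<in> sets lebesgue" by (intro sets.Un) auto
  then show ?thesis using FE by (simp add: Un_absorb1)
qed

text \<open>The image of area under the modulus has a density, so null sets of radii pull back to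
  null sets in the plane.\<close>

lemma AE_radial:
  assumes "AE r in lborel. r \<in> {0..<1} \<longrightarrow> P r"
  shows "AE z in lborel. z \<in> unit_disc \<longrightarrow> P (cmod z)"
proof -
  obtain N where N: "N \<in> null_sets lborel" "\<And>r. r \<in> {0..<1} \<Longrightarrow> \<not> P r \<Longrightarrow> r \<in> N"
    using assms unfolding eventually_ae_filter by auto
  then have [measurable]: "N \<in> sets borel" by auto
  have "AE r in lborel. r \<notin> N" using N(1) by (rule AE_not_in)
  then have "AE r in distr lborel borel cmod. r \<notin> N"
    unfolding lborel_distr_cmod by (subst AE_density) auto
  then have "AE z in lborel. cmod z \<notin> N"
    by (subst (asm) AE_distr_iff) auto
  then show ?thesis
  proof eventually_elim
    case (elim z)
    then show ?case using N(2)[of "cmod z"] by auto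
  qed
qed

text \<open>Measurability on the plane says nothing about restriction to a line, a null set;
  superlevel sets of a radial function are radial, and \<open>lebesgue_radial_profile\<close>
  transfers them to the radius. The Borel version serves both norms: its equality with the weight is
  needed along the radius for L and over the disc for T.\<close>

lemma radial_weight_borel_profile:
  assumes "radial_weight \<omega>"
  obtains w :: "real \<Rightarrow> real" where "w \<in> borel_measurable borel" "\<And>r. 0 \<le> w r"
    "AE r in lborel. r \<in> {0..<1} \<longrightarrow> \<omega> (of_real r) = w r"
    "AE z in lborel. z \<in> unit_disc \<longrightarrow> \<omega> z = w (cmod z)"
    "(\<integral>\<^sup>+z\<in>unit_disc. ennreal (w (cmod z)) \<partial>lborel) < top"
    "(\<integral>\<^sup>+r\<in>{0..<1}. ennreal (w r * r) \<partial>lborel) < top"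
proof -
  have nonneg: "\<And>z. z \<in> unit_disc \<Longrightarrow> 0 \<le> \<omega> z" and int: "set_integrable lebesgue unit_disc \<omega>"
    and rad: "\<And>z. z \<in> unit_disc \<Longrightarrow> \<omega> z = \<omega> (of_real (cmod z))"
    using assms unfolding radial_weight_def weight_def by blast+
  define v where "v r = (if r \<in> {0..<1} then \<omega> (of_real r) else 0)" for r :: real
  have v0: "0 \<le> v r" for r unfolding v_def by (auto intro: nonneg)
  have meas: "(\<lambda>z. indicator unit_disc z *\<^sub>R \<omega> z) \<in> borel_measurable lebesgue"
    using int unfolding set_integrable_def by (rule borel_measurable_integrable)
  have "v \<in> borel_measurable lebesgue"
  proof (rule borel_measurableI_greater)
    fix a :: real
    show "{r \<in> space lebesgue. a < v r} \<in> sets lebesgue"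
    proof (cases "a < 0")
      case True
      then have "{r \<in> space lebesgue. a < v r} = UNIV" using v0 by (auto intro: less_le_trans)
      then show ?thesis by simp
    next
      case False
      \<comment> \<open>With a >= 0 the zero values outside the disc drop out on both sides.\<close>
      have "{z. cmod z \<in> {r. a < v r}} = {z \<in> space lebesgue. a < indicator unit_disc z *\<^sub>R \<omega> z}"
      proof (intro Collect_cong)
        fix z
        show "cmod z \<in> {r. a < v r} \<longleftrightarrow> z \<in> space lebesgue \<and> a < indicator unit_disc z *\<^sub>R \<omega> z"
          using False rad[of z] by (cases "z \<in> unit_disc") (simp_all add: v_def)
      qed
      also have "\<dots> \<in> sets lebesgue" using meas by measurable
      finally have "{r. a < v r} \<in> sets lebesgue"
        using False by (intro lebesgue_radial_profile) (auto simp: v_def split: if_splits)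
      then show ?thesis by simp
    qed
  qed
  then obtain v' where v' [measurable]: "v' \<in> borel_measurable lborel" and AEv: "AE r in lborel. v r = v' r"
    using completion_ex_borel_measurable_real by blast
  define w where "w r = max 0 (v' r)" for r
  have w_meas [measurable]: "w \<in> borel_measurable borel" using v' unfolding w_def by simp
  have w0: "0 \<le> w r" for r by (simp add: w_def)
  have AE1: "AE r in lborel. r \<in> {0..<1} \<longrightarrow> \<omega> (of_real r) = w r"
    using AEv
  proof eventually_elim
    case (elim r)
    then show ?case using v0[of r] by (auto simp: w_def v_def)
  qed
  have AE2: "AE z in lborel. z \<in> unit_disc \<longrightarrow> \<omega> z = w (cmod z)"
    using AE_radial[OF AE1]
  proof eventually_elim
    case (elim z)
    then show ?case using rad[of z] by simp
  qed
  have "(\<integral>\<^sup>+z\<in>unit_disc. ennreal (w (cmod z)) \<partial>lborel) = (\<integral>\<^sup>+z. ennreal (norm (indicator unit_disc z *\<^sub>R \<omega> z)) \<partial>lebesgue)"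
    unfolding nn_integral_completion
    by (rule nn_integral_cong_AE, use AE2 in eventually_elim) (use nonneg w0 in \<open>auto split: split_indicator\<close>)
  also have "\<dots> < top"
    using int unfolding set_integrable_def integrable_iff_bounded by (simp add: less_top)
  finally have fin: "(\<integral>\<^sup>+z\<in>unit_disc. ennreal (w (cmod z)) \<partial>lborel) < top" .
  have "(\<integral>\<^sup>+z\<in>unit_disc. ennreal (w (cmod z)) \<partial>lborel) = (\<integral>\<^sup>+z. ennreal (w (cmod z)) * indicator {..<1} (cmod z) \<partial>lborel)"
    by (intro nn_integral_cong) (auto split: split_indicator)
  also have "\<dots> = (\<integral>\<^sup>+r\<in>{0..}. ennreal (2 * pi * r) * (ennreal (w r) * indicator {..<1} r) \<partial>lborel)"
    by (rule nn_integral_radial) measurable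
  also have "\<dots> = (\<integral>\<^sup>+r. ennreal (2 * pi) * (ennreal (w r * r) * indicator {0..<1} r) \<partial>lborel)"
    using w0 by (intro nn_integral_cong) (auto simp: ennreal_mult'' mult_ac simp flip: ennreal_mult split: split_indicator)
  also have "\<dots> = ennreal (2 * pi) * (\<integral>\<^sup>+r\<in>{0..<1}. ennreal (w r * r) \<partial>lborel)"
    by (rule nn_integral_cmult) measurable
  finally have "(\<integral>\<^sup>+r\<in>{0..<1}. ennreal (w r * r) \<partial>lborel) < top"
    using fin by (auto simp: ennreal_mult_less_top)
  then show ?thesis using that w_meas w0 AE1 AE2 fin by blast
qed

section \<open>The two quasinorms as mixed norms\<close>

lemma L_norm_mixed_quasinorm:
  assumes "radial_weight \<omega>" and pq: "0 < p" "0 < q"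
  obtains \<nu> where "mixed_quasinorm \<nu> p q (1 / (2 * pi)) (L_norm p q \<omega>)"
proof -
  obtain w where w [measurable]: "w \<in> borel_measurable borel" and w0: "\<And>r. 0 \<le> w r"
    and AEw: "AE r in lborel. r \<in> {0..<1} \<longrightarrow> \<omega> (of_real r) = w r"
    and fin: "(\<integral>\<^sup>+r\<in>{0..<1}. ennreal (w r * r) \<partial>lborel) < top"
    by (rule radial_weight_borel_profile[OF assms(1)]) blast
  \<comment> \<open>The measure lives on the real radius; multiplication by
    \<open>cis \<theta>\<close> carries it to the radius at angle \<theta>.\<close>
  define \<nu> where "\<nu> = distr (density lborel (\<lambda>r. ennreal (w r * r) * indicator {0..<1} r)) borel complex_of_real"
  have "emeasure \<nu> (space \<nu>) = (\<integral>\<^sup>+r\<in>{0..<1}. ennreal (w r * r) \<partial>lborel)"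
    unfolding \<nu>_def by (simp add: emeasure_distr emeasure_density)
  then have "disc_measure \<nu>"
    using fin by (intro disc_measure.intro finite_measureI disc_measure_axioms.intro) (auto simp: \<nu>_def)
  then interpret disc_measure \<nu> .
  have "mixed_quasinorm \<nu> p q (1 / (2 * pi)) (L_norm p q \<omega>)"
  proof unfold_locales
    fix f :: "complex \<Rightarrow> complex" assume cf [simp]: "continuous_on unit_disc f"
    have "(\<integral>\<^sup>+r\<in>{0..<1}. ennreal (cmod (f (rcis r \<theta>)) powr p * \<omega> (of_real r) * r) \<partial>lborel) = ray_int p \<nu> f \<theta>" for \<theta>
    proof -
      have "ray_int p \<nu> f \<theta> = (\<integral>\<^sup>+r. ennreal (w r * r) * indicator {0..<1} r * rot_powr p f \<theta> (of_real r) \<partial>lborel)"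
      proof -
        have [measurable]: "rot_powr p f \<theta> \<in> borel_measurable borel"
          using measurable_rot_powr[OF cf, of "\<lambda>_. \<theta>" borel "\<lambda>z. z"] by simp
        show ?thesis unfolding ray_int_def \<nu>_def by (simp add: nn_integral_distr nn_integral_density)
      qed
      also have "\<dots> = (\<integral>\<^sup>+r\<in>{0..<1}. ennreal (cmod (f (rcis r \<theta>)) powr p * \<omega> (of_real r) * r) \<partial>lborel)"
        by (rule nn_integral_cong_AE, use AEw in eventually_elim)
          (auto simp: rot_powr_def rcis_def mult_ac w0 simp flip: ennreal_mult split: split_indicator)
      finally show ?thesis ..
    qed
    then show "L_norm p q \<omega> f = epowr (ennreal (1 / (2 * pi)) * mixed_int p q \<nu> f) (1 / q)"
      unfolding L_norm_def mixed_int_def nn_integral_completion by simp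
  qed (use pq in auto)
  then show ?thesis by (rule that)
qed

section \<open>Tangential regions: rotation and integrability\<close>

lemma Arg_measurable [measurable]: "Arg \<in> borel_measurable borel"
proof -
  have "(\<lambda>z. if z = 0 then 0 else Im (Ln z)) \<in> borel_measurable borel" by measurable
  also have "(\<lambda>z. if z = 0 then 0 else Im (Ln z)) = Arg"
    by (auto simp: Arg_eq_Im_Ln Arg_zero)
  finally show ?thesis .
qed

lemma Arg_mult_cis:
  assumes "z \<noteq> 0"
  obtains m :: int where "Arg (z * cis t) = Arg z + t + 2 * pi * of_int m"
proof -
  have "cis (Arg (z * cis t)) = cis (Arg z + t)"
    using assms by (simp add: cis_Arg sgn_mult cis_mult[symmetric])
  then have "sin (Arg (z * cis t)) = sin (Arg z + t) \<and> cos (Arg (z * cis t)) = cos (Arg z + t)"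
    by (auto simp: complex_eq_iff)
  then show ?thesis unfolding sin_cos_eq_iff using that by blast
qed

lemma ex_int_shift: "(\<exists>k::int. P (k + m)) \<longleftrightarrow> (\<exists>k. P k)"
  by (metis diff_add_cancel)

text \<open>\<open>Arg (cis t)\<close> differs from t by a multiple of 2 pi, which the integer k
  absorbs. Without \<open>Arg (cis t)\<close> the condition is visibly Borel in t and z
  jointly.\<close>

lemma mem_tangential_region_cis:
  "z \<in> tangential_region (cis t) \<longleftrightarrow> z \<in> unit_disc \<and> (\<exists>k::int. \<bar>Arg z - t + 2 * pi * of_int k\<bar> < 1 - cmod z)"
proof -
  obtain m where m: "Arg (cis t) = t + 2 * pi * of_int m"
    using Arg_mult_cis[of 1 t] by auto
  have "Arg z - Arg (cis t) + 2 * pi * of_int (k + m) = Arg z - t + 2 * pi * of_int k" for k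
    by (simp add: m algebra_simps)
  then have "(\<exists>k::int. \<bar>Arg z - Arg (cis t) + 2 * pi * of_int k\<bar> < 1 - cmod z) \<longleftrightarrow>
      (\<exists>k::int. \<bar>Arg z - t + 2 * pi * of_int k\<bar> < 1 - cmod z)"
    using ex_int_shift[of "\<lambda>k. \<bar>Arg z - Arg (cis t) + 2 * pi * of_int k\<bar> < 1 - cmod z" m] by (simp only:)
  then show ?thesis by (simp add: tangential_region_def)
qed

text \<open>The origin is excluded because the convention \<open>Arg 0 = 0\<close> is not compatible
  with rotation.\<close>

lemma tangential_region_rotate:
  assumes "z \<noteq> 0"
  shows "z * cis t \<in> tangential_region (cis t) \<longleftrightarrow> z \<in> tangential_region 1"
proof -
  obtain m where m: "Arg (z * cis t) = Arg z + t + 2 * pi * of_int m"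
    using Arg_mult_cis[OF assms] .
  have "Arg (z * cis t) - t + 2 * pi * of_int k = Arg z - 0 + 2 * pi * of_int (k + m)" for k
    by (simp add: m algebra_simps)
  then show ?thesis
    using mem_tangential_region_cis[of "z * cis t" t] mem_tangential_region_cis[of z 0]
      ex_int_shift[of "\<lambda>k. \<bar>Arg z - 0 + 2 * pi * of_int k\<bar> < 1 - cmod z" m]
    by (simp add: norm_mult)
qed

lemma tangential_region_measurable [measurable]:
  "Measurable.pred (borel \<Otimes>\<^sub>M borel) (\<lambda>(t, z). z \<in> tangential_region (cis t))"
  unfolding mem_tangential_region_cis split_beta by measurable

text \<open>With Arg z in (-pi, pi], t in [0, 2 pi] and a deviation below 1, only k = 0 and k = 1
  are possible; each gives an interval of length 2 (1 - |z|).\<close>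

lemma tangential_region_section:
  "(\<integral>\<^sup>+t\<in>{0..2*pi}. indicator (tangential_region (cis t)) z \<partial>lborel) \<le> ennreal (4 * (1 - cmod z)) * indicator unit_disc z"
proof (cases "z \<in> unit_disc")
  case True
  define I where "I k = {Arg z + 2 * pi * of_int k - (1 - cmod z)<..<Arg z + 2 * pi * of_int k + (1 - cmod z)}" for k :: int
  have sub: "indicator (tangential_region (cis t)) z * indicator {0..2*pi} t \<le> (indicator (I 0) t + indicator (I 1) t :: ennreal)" for t
  proof (cases "z \<in> tangential_region (cis t) \<and> t \<in> {0..2*pi}")
    case True
    then obtain k :: int where k: "\<bar>Arg z - t + 2 * pi * of_int k\<bar> < 1 - cmod z" and t: "0 \<le> t" "t \<le> 2 * pi"
      unfolding mem_tangential_region_cis by auto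
    have lt: "\<bar>Arg z - t + 2 * pi * of_int k\<bar> < 1" using k by (smt (verit) norm_ge_zero)
    have Arg: "- pi < Arg z" "Arg z \<le> pi" by (rule mpi_less_Arg Arg_le_pi)+
    have pi3: "pi > 3" by (rule pi_gt3)
    have "2 * pi * of_int k < 2 * pi * 2" using lt Arg t pi3 by linarith
    then have "of_int k < (2::real)" by simp
    moreover have "2 * pi * of_int k > 2 * pi * (-1)" using lt Arg t pi3 by linarith
    then have "of_int k > (-1::real)" by (subst (asm) mult_less_cancel_left_pos) auto
    ultimately have "k = 0 \<or> k = 1" by linarith
    then have "t \<in> I 0 \<or> t \<in> I 1" using k unfolding I_def by auto
    then show ?thesis by (auto split: split_indicator)
  qed auto
  have eI: "emeasure lborel (I k) = ennreal (2 * (1 - cmod z))" for k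
    unfolding I_def using True by (subst emeasure_lborel_Ioo) auto
  have "(\<integral>\<^sup>+t\<in>{0..2*pi}. indicator (tangential_region (cis t)) z \<partial>lborel) \<le> (\<integral>\<^sup>+t. indicator (I 0) t + indicator (I 1) t \<partial>lborel)"
    by (intro nn_integral_mono sub)
  also have "\<dots> = emeasure lborel (I 0) + emeasure lborel (I 1)"
    by (subst nn_integral_add) (auto simp: I_def)
  also have "\<dots> = ennreal (4 * (1 - cmod z))"
    unfolding eI using True by (simp flip: ennreal_plus)
  finally show ?thesis using True by simp
next
  case False
  then have "z \<notin> tangential_region (cis t)" for t by (simp add: mem_tangential_region_cis)
  then show ?thesis by simp
qed

text \<open>Rotation invariance of area; the exceptional origin is a null set.\<close>

lemma nn_integral_tangential_rotate:
  assumes [measurable]: "F \<in> borel_measurable borel"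
  shows "(\<integral>\<^sup>+z\<in>tangential_region (cis t). F z \<partial>lborel) = (\<integral>\<^sup>+z\<in>tangential_region 1. F (z * cis t) \<partial>lborel)"
proof -
  have [measurable]: "(\<lambda>z. z * cis t) \<in> borel_measurable borel" by measurable
  have [measurable]: "tangential_region (cis t) \<in> sets borel"
  proof -
    have "Measurable.pred borel (\<lambda>z. z \<in> tangential_region (cis t))"
      unfolding mem_tangential_region_cis by measurable
    then show ?thesis by (simp add: pred_def)
  qed
  have "(\<integral>\<^sup>+z\<in>tangential_region (cis t). F z \<partial>lborel) =
      (\<integral>\<^sup>+z. F z * indicator (tangential_region (cis t)) z \<partial>distr lborel borel (\<lambda>z. z * cis t))"
    by (simp only: lborel_distr_rotation)
  also have "\<dots> = (\<integral>\<^sup>+z. F (z * cis t) * indicator (tangential_region (cis t)) (z * cis t) \<partial>lborel)"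
    by (subst nn_integral_distr) auto
  also have "\<dots> = (\<integral>\<^sup>+z\<in>tangential_region 1. F (z * cis t) \<partial>lborel)"
    by (rule nn_integral_cong_AE, use AE_lborel_singleton[of "0::complex"] in eventually_elim)
      (auto simp: tangential_region_rotate split: split_indicator)
  finally show ?thesis .
qed

text \<open>By rotation all regions give the same integral, so it equals its mean over t. Fubini and
  \<open>tangential_region_section\<close> cancel the factor 1 / (1 - |z|), leaving the integral of
  the weight over the disc.\<close>

lemma nn_integral_tangential_finite:
  fixes w :: "real \<Rightarrow> real"
  assumes [measurable]: "w \<in> borel_measurable borel" and w0: "\<And>r. 0 \<le> w r"
    and fin: "(\<integral>\<^sup>+z\<in>unit_disc. ennreal (w (cmod z)) \<partial>lborel) < top"
  shows "(\<integral>\<^sup>+z\<in>tangential_region 1. ennreal (w (cmod z) / (1 - cmod z)) \<partial>lborel) < top"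
proof -
  let ?F = "\<lambda>z. ennreal (w (cmod z) / (1 - cmod z))"
  let ?I = "\<integral>\<^sup>+z\<in>tangential_region 1. ?F z \<partial>lborel"
  have "(\<integral>\<^sup>+z\<in>tangential_region (cis t). ?F z \<partial>lborel) = ?I" for t
    by (subst nn_integral_tangential_rotate) (auto simp: norm_mult)
  moreover have "(\<integral>\<^sup>+t. ?I * indicator {0..2*pi} t \<partial>lborel) = ?I * emeasure lborel {0..2*pi}"
    by (rule nn_integral_cmult_indicator) simp
  ultimately have "ennreal (2 * pi) * ?I = (\<integral>\<^sup>+t. (\<integral>\<^sup>+z\<in>tangential_region (cis t). ?F z \<partial>lborel) * indicator {0..2*pi} t \<partial>lborel)"
    by (simp only:) (simp add: mult.commute)
  also have "\<dots> = (\<integral>\<^sup>+t. (\<integral>\<^sup>+z. ?F z * indicator (tangential_region (cis t)) z * indicator {0..2*pi} t \<partial>lborel) \<partial>lborel)"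
    by (intro nn_integral_cong) (auto split: split_indicator)
  also have "\<dots> = (\<integral>\<^sup>+z. (\<integral>\<^sup>+t. ?F z * indicator (tangential_region (cis t)) z * indicator {0..2*pi} t \<partial>lborel) \<partial>lborel)"
    by (rule lborel_pair.Fubini'[symmetric]) simp
  also have "\<dots> = (\<integral>\<^sup>+z. ?F z * (\<integral>\<^sup>+t\<in>{0..2*pi}. indicator (tangential_region (cis t)) z \<partial>lborel) \<partial>lborel)"
    by (intro nn_integral_cong) (simp add: mult.assoc nn_integral_cmult)
  also have "\<dots> \<le> (\<integral>\<^sup>+z. ?F z * (ennreal (4 * (1 - cmod z)) * indicator unit_disc z) \<partial>lborel)"
    by (intro nn_integral_mono mult_left_mono tangential_region_section) auto
  also have "\<dots> = (\<integral>\<^sup>+z. 4 * (ennreal (w (cmod z)) * indicator unit_disc z) \<partial>lborel)"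
  proof (intro nn_integral_cong)
    fix z
    have "?F z * ennreal (4 * (1 - cmod z)) = 4 * ennreal (w (cmod z))" if "cmod z < 1"
    proof -
      have cancel: "x / y * (4 * y) = 4 * x" if "y \<noteq> 0" for x y :: real
        using that by simp
      have "w (cmod z) / (1 - cmod z) * (4 * (1 - cmod z)) = 4 * w (cmod z)"
        by (rule cancel) (use that in simp)
      then have "?F z * ennreal (4 * (1 - cmod z)) = ennreal (4 * w (cmod z))"
        using that w0[of "cmod z"] by (subst ennreal_mult[symmetric]) auto
      then show ?thesis using w0[of "cmod z"] by (simp add: ennreal_mult)
    qed
    then show "?F z * (ennreal (4 * (1 - cmod z)) * indicator unit_disc z) = 4 * (ennreal (w (cmod z)) * indicator unit_disc z)"
      by (auto split: split_indicator)
  qed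
  also have "\<dots> = 4 * (\<integral>\<^sup>+z\<in>unit_disc. ennreal (w (cmod z)) \<partial>lborel)"
    by (rule nn_integral_cmult) measurable
  also have "\<dots> < top" using fin by (simp add: ennreal_mult_less_top)
  finally show ?thesis by (auto simp: ennreal_mult_less_top)
qed

lemma T_norm_mixed_quasinorm:
  assumes "radial_weight \<omega>" and pq: "0 < p" "0 < q"
  obtains \<nu> where "mixed_quasinorm \<nu> p q 1 (T_norm p q \<omega>)"
proof -
  obtain w where w [measurable]: "w \<in> borel_measurable borel" and w0: "\<And>r. 0 \<le> w r"
    and AEw: "AE z in lborel. z \<in> unit_disc \<longrightarrow> \<omega> z = w (cmod z)"
    and fin: "(\<integral>\<^sup>+z\<in>unit_disc. ennreal (w (cmod z)) \<partial>lborel) < top"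
    by (rule radial_weight_borel_profile[OF assms(1)]) blast
  \<comment> \<open>The factor 1 / pi of the normalised area is part of the measure, whence K =
    1.\<close>
  define d where "d z = ennreal (1 / pi) * (ennreal (w (cmod z) / (1 - cmod z)) * indicator (tangential_region 1) z)" for z
  define \<nu> where "\<nu> = density lborel d"
  have region [measurable]: "tangential_region 1 \<in> sets borel"
  proof -
    have "Measurable.pred borel (\<lambda>z. z \<in> tangential_region (cis 0))"
      unfolding mem_tangential_region_cis by measurable
    then show ?thesis by (simp add: pred_def)
  qed
  have [measurable]: "d \<in> borel_measurable borel" unfolding d_def by measurable
  have "emeasure \<nu> (space \<nu>) = ennreal (1 / pi) * (\<integral>\<^sup>+z\<in>tangential_region 1. ennreal (w (cmod z) / (1 - cmod z)) \<partial>lborel)"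
    unfolding \<nu>_def by (simp add: emeasure_density d_def nn_integral_cmult)
  also have "\<dots> < top"
    using nn_integral_tangential_finite[OF w w0 fin] by (simp add: ennreal_mult_less_top)
  finally have "disc_measure \<nu>"
    by (intro disc_measure.intro finite_measureI disc_measure_axioms.intro) (auto simp: \<nu>_def)
  then interpret disc_measure \<nu> .
  have "mixed_quasinorm \<nu> p q 1 (T_norm p q \<omega>)"
  proof unfold_locales
    fix f :: "complex \<Rightarrow> complex" assume cf [simp]: "continuous_on unit_disc f"
    have "ennreal (1 / pi) * (\<integral>\<^sup>+z\<in>tangential_region (cis t). ennreal (cmod (f z) powr p * \<omega> z / (1 - cmod z)) \<partial>lborel)
      = ray_int p \<nu> f t" for t
    proof -
      \<comment> \<open>A Borel version of the integrand: the weight is replaced by its profile, and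
        f is cut off outside the disc.\<close>
      define F where "F z = rot_powr p f 0 z * ennreal (w (cmod z) / (1 - cmod z))" for z
      have [measurable]: "F \<in> borel_measurable borel" unfolding F_def by measurable
      have "(\<integral>\<^sup>+z\<in>tangential_region (cis t). ennreal (cmod (f z) powr p * \<omega> z / (1 - cmod z)) \<partial>lborel)
        = (\<integral>\<^sup>+z\<in>tangential_region (cis t). F z \<partial>lborel)"
      proof (rule nn_integral_cong_AE, use AEw in eventually_elim)
        fix z assume z: "z \<in> unit_disc \<longrightarrow> \<omega> z = w (cmod z)"
        show "ennreal (cmod (f z) powr p * \<omega> z / (1 - cmod z)) * indicator (tangential_region (cis t)) z
          = F z * indicator (tangential_region (cis t)) z"
        proof (cases "z \<in> tangential_region (cis t)")
          case True
          then have "cmod z < 1" by (simp add: mem_tangential_region_cis)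
          then show ?thesis using z w0[of "cmod z"] by (simp add: F_def rot_powr_def flip: ennreal_mult)
        qed simp
      qed
      also have "\<dots> = (\<integral>\<^sup>+z\<in>tangential_region 1. F (z * cis t) \<partial>lborel)"
        by (rule nn_integral_tangential_rotate) measurable
      also have "\<dots> = (\<integral>\<^sup>+z. rot_powr p f t z * (ennreal (w (cmod z) / (1 - cmod z)) * indicator (tangential_region 1) z) \<partial>lborel)"
        by (intro nn_integral_cong) (auto simp: F_def rot_powr_def norm_mult mult_ac split: split_indicator)
      finally have "ennreal (1 / pi) * (\<integral>\<^sup>+z\<in>tangential_region (cis t). ennreal (cmod (f z) powr p * \<omega> z / (1 - cmod z)) \<partial>lborel)
        = (\<integral>\<^sup>+z. ennreal (1 / pi) * (rot_powr p f t z * (ennreal (w (cmod z) / (1 - cmod z)) * indicator (tangential_region 1) z)) \<partial>lborel)"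
        by (simp add: nn_integral_cmult)
      also have "\<dots> = (\<integral>\<^sup>+z. d z * rot_powr p f t z \<partial>lborel)"
        by (intro nn_integral_cong) (simp add: d_def mult_ac)
      also have "\<dots> = ray_int p \<nu> f t"
        unfolding ray_int_def \<nu>_def by (rule nn_integral_density[symmetric]) simp_all
      finally show ?thesis .
    qed
    then show "T_norm p q \<omega> f = epowr (ennreal 1 * mixed_int p q \<nu> f) (1 / q)"
      unfolding T_norm_def mixed_int_def nn_integral_completion by simp
  qed (use pq in auto)
  then show ?thesis by (rule that)
qed

lemma holomorphic_measurable_disc:
  assumes "f holomorphic_on unit_disc"
  shows "f \<in> borel_measurable (lebesgue_on unit_disc)"
  using assms by (intro continuous_imp_measurable_on_sets_lebesgue holomorphic_on_imp_continuous_on) auto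

theorem theorem1p2:
  fixes p q :: real
    and AX :: "(complex \<Rightarrow> real) \<Rightarrow> (complex \<Rightarrow> complex) set"
    and N :: "(complex \<Rightarrow> real) \<Rightarrow> (complex \<Rightarrow> complex) \<Rightarrow> ennreal"
  assumes "0 < p" and "0 < q"
    and "(AX = AL p q \<and> N = L_norm p q) \<or> (AX = AT p q \<and> N = T_norm p q)"
  shows "(\<exists>C::real. 0 < C \<and>
            (\<forall>\<omega>. radial_weight \<omega> \<longrightarrow>
              (\<forall>c\<in>cball 0 1. \<forall>f\<in>H_disc. N \<omega> (dilate c f) \<le> ennreal C * N \<omega> f))) \<and>
         (\<forall>\<omega>. radial_weight \<omega> \<longrightarrow>
            (\<forall>f\<in>AX \<omega>. \<forall>\<zeta>\<in>cball 0 1.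
              ((\<lambda>c. N \<omega> (\<lambda>z. dilate c f z - dilate \<zeta> f z)) \<longlongrightarrow> 0) (at \<zeta> within cball 0 1))) \<and>
         (\<forall>\<omega>. radial_weight \<omega> \<longrightarrow> quasinorm_dense (range poly) (AX \<omega>) (N \<omega>))"
proof -
  \<comment> \<open>Measurability is automatic for analytic functions, so each space is described by
    finiteness of its quasinorm.\<close>
  have AX: "AX \<omega> = {f. f holomorphic_on unit_disc \<and> N \<omega> f < top}" for \<omega>
    using assms(3) holomorphic_measurable_disc
    by (auto simp: AL_def AT_def L_space_def T_space_def H_disc_def)
  have ex: "\<exists>\<nu> K. mixed_quasinorm \<nu> p q K (N \<omega>)" if "radial_weight \<omega>" for \<omega>
    using assms(3) L_norm_mixed_quasinorm[OF that assms(1,2)] T_norm_mixed_quasinorm[OF that assms(1,2)] by metis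
  have "N \<omega> (dilate c f) \<le> ennreal 1 * N \<omega> f" if "radial_weight \<omega>" "c \<in> cball 0 1" "f \<in> H_disc" for \<omega> c f
  proof -
    from ex[OF that(1)] obtain \<nu> K where "mixed_quasinorm \<nu> p q K (N \<omega>)" by blast
    then interpret mixed_quasinorm \<nu> p q K "N \<omega>" .
    show ?thesis using N_dilate_le that by (simp add: H_disc_def)
  qed
  \<comment> \<open>The witness 1 is chosen before the weight, as the required uniformity
    demands.\<close>
  then have 1: "\<exists>C::real. 0 < C \<and> (\<forall>\<omega>. radial_weight \<omega> \<longrightarrow>
      (\<forall>c\<in>cball 0 1. \<forall>f\<in>H_disc. N \<omega> (dilate c f) \<le> ennreal C * N \<omega> f))"
    by (intro exI[of _ 1]) auto
  have 2: "((\<lambda>c. N \<omega> (\<lambda>z. dilate c f z - dilate \<zeta> f z)) \<longlongrightarrow> 0) (at \<zeta> within cball 0 1)"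
    if "radial_weight \<omega>" "f \<in> AX \<omega>" "\<zeta> \<in> cball 0 1" for \<omega> f \<zeta>
  proof -
    from ex[OF that(1)] obtain \<nu> K where "mixed_quasinorm \<nu> p q K (N \<omega>)" by blast
    then interpret mixed_quasinorm \<nu> p q K "N \<omega>" .
    show ?thesis using that by (intro N_dilate_tendsto) (auto simp: AX)
  qed
  have 3: "quasinorm_dense (range poly) (AX \<omega>) (N \<omega>)" if "radial_weight \<omega>" for \<omega>
  proof -
    from ex[OF that(1)] obtain \<nu> K where "mixed_quasinorm \<nu> p q K (N \<omega>)" by blast
    then interpret mixed_quasinorm \<nu> p q K "N \<omega>" .
    have "range poly \<subseteq> AX \<omega>"
      by (auto simp: AX N_poly_finite intro!: holomorphic_intros)
    moreover have "\<exists>g\<in>range poly. N \<omega> (\<lambda>z. f z - g z) < ennreal \<epsilon>" if "f \<in> AX \<omega>" "0 < \<epsilon>" for f \<epsilon>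
      using N_poly_approx[of f \<epsilon>] that by (auto simp: AX)
    ultimately show ?thesis unfolding quasinorm_dense_def by blast
  qed
  show ?thesis using 1 2 3 by blast
qed

end
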